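(* Suppose that a point $\lambda_0\in\mathbb{C}$ is a point of analyticity of $M_B$ and is also a limit point of points of analyticity of $\lambda\mapsto (A_B-\lambda I)^{-1}$, that is, $\lambda_0\in\overline{\rho(A_B)}$. For positive integers $N$ and $M$, let $P_{N,\mathcal{S}}$ and $P_{M,\tilde{\mathcal{S}}}$ denote the orthogonal projections onto any $N$-dimensional subspace of $\mathcal{S}$ and any $M$-dimensional subspace of $\tilde{\mathcal{S}}$ respectively. Then $P_{M,\tilde{\mathcal{S}}}(A_B-\lambda I)^{-1}P_{N,\mathcal{S}}$ is analytic at $\lambda=\lambda_0$. Likewise, if $P_{N,\mathcal{T}}$ and $P_{M,\tilde{\mathcal{T}}}$ denote the orthogonal projections onto any $N$-dimensional subspace of $\mathcal{T}$ and any $M$-dimensional subspace of $\tilde{\mathcal{T}}$, then $P_{M,\tilde{\mathcal{T}}}(A_B-\lambda I)^{-1}P_{N,\mathcal{T}}$ is analytic at $\lambda=\lambda_0$.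
   Context: $H$ is a complex Hilbert space; $A$ and $\tilde{A}$ are closed, densely defined operators in $H$ forming an adjoint pair, i.e. $A^*\supseteq\tilde{A}$ and $\tilde{A}^*\supseteq A$. A boundary triplet for this pair is fixed: Hilbert spaces $\mathcal{H},\mathcal{K}$ and linear operators $\Gamma_1:D(\tilde{A}^* )\to\mathcal{H}$, $\Gamma_2:D(\tilde{A}^* )\to\mathcal{K}$, $\tilde{\Gamma}_1:D(A^* )\to\mathcal{K}$, $\tilde{\Gamma}_2:D(A^* )\to\mathcal{H}$, bounded with respect to the graph norms, such that $(\Gamma_1,\Gamma_2)$ is surjective onto $\mathcal{H}\times\mathcal{K}$, $(\tilde{\Gamma}_1,\tilde{\Gamma}_2)$ is surjective onto $\mathcal{K}\times\mathcal{H}$, $D(A)=D(\tilde{A}^* )\cap\ker\Gamma_1\cap\ker\Gamma_2$, $D(\tilde{A})=D(A^* )\cap\ker\tilde{\Gamma}_1\cap\ker\tilde{\Gamma}_2$, and for all $u\in D(\tilde{A}^* )$, $v\in D(A^* )$ $$(\tilde{A}^*u,v)_H-(u,A^*v)_H=(\Gamma_1u,\tilde{\Gamma}_2v)_{\mathcal{H}}-(\Gamma_2u,\tilde{\Gamma}_1v)_{\mathcal{K}}.$$ Let $B:\mathcal{K}\to\mathcal{H}$ be a bounded linear operator, $A_B:=\tilde{A}^*|_{\ker(\Gamma_1-B\Gamma_2)}$ and $\tilde{A}_{B^*}:=A^*|_{\ker(\tilde{\Gamma}_1-B^*\tilde{\Gamma}_2)}$ (it is known that $\tilde{A}_{B^*}=(A_B)^*$).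 Assume $\rho(A_B)\neq\emptyset$. For $\lambda\in\rho(A_B)$, the $M$-function $M_B(\lambda):\mathrm{Ran}(\Gamma_1-B\Gamma_2)\to\mathcal{K}$ is the operator with $M_B(\lambda)(\Gamma_1-B\Gamma_2)u=\Gamma_2u$ for all $u\in\ker(\tilde{A}^*-\lambda)$; it is analytic on $\rho(A_B)$. A point $\lambda_0\in\mathbb{C}$ is called a point of analyticity of $M_B$ if all analytic continuations of $M_B$ coincide in a neighbourhood of $\lambda_0$ (so that $M_B$ is given near $\lambda_0$ by a single function analytic in a neighbourhood of $\lambda_0$). "Analytic at $\lambda_0$" for the compressed resolvents, which are defined for $\lambda\in\rho(A_B)$, is understood in the same sense of analytic continuation. The solution operators are $S_{\mu,B}=\left((\Gamma_1-B\Gamma_2)|_{\ker(\tilde{A}^*-\mu)}\right)^{-1}$ for $\mu\in\rho(A_B)$ and $\tilde{S}_{\mu,B^*}=\left((\tilde{\Gamma}_1-B^*\tilde{\Gamma}_2)|_{\ker(A^*-\mu)}\right)^{-1}$ for $\mu\in\rho(\tilde{A}_{B^*})$. Fix $\mu_0\notin\sigma(A_B)$ and $\tilde{\mu}\notin\sigma(\tilde{A}_{B^*})$ and define, with $\mathrm{Span}$ denoting the set of finite linear combinations of vectors from the indicated sets, $$\mathcal{S}=\mathrm{Span}_{\delta\notin\sigma(A_B)}(A_B-\delta I)^{-1}\mathrm{Ran}(S_{\mu_0,B}),\qquad \mathcal{T}=\mathrm{Span}_{\mu\notin\sigma(A_B)}\mathrm{Ran}(S_{\mu,B}),$$ $$\tilde{\mathcal{S}}=\mathrm{Span}_{\delta\notin\sigma(\tilde{A}_{B^*})}(\tilde{A}_{B^*}-\delta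 I)^{-1}\mathrm{Ran}(\tilde{S}_{\tilde{\mu},B^*}),\qquad \tilde{\mathcal{T}}=\mathrm{Span}_{\mu\notin\sigma(\tilde{A}_{B^*})}\mathrm{Ran}(\tilde{S}_{\mu,B^*}).$$ *)

theory Defs
  imports "HOL-Analysis.Analysis"
begin

section \<open>Complex Hilbert spaces\<close>

text \<open>
  The inner product \<open>cinner\<close> is linear in its first and antilinear in its second argument.
  The superclass \<open>real_inner\<close> supplies the norm, the topology and the underlying real structure.
\<close>

class complex_inner = real_inner +
  fixes scaleC :: "complex \<Rightarrow> 'a \<Rightarrow> 'a"  (infixr \<open>*\<^sub>C\<close> 75)
    and cinner :: "'a \<Rightarrow> 'a \<Rightarrow> complex"
  assumes scaleC_add_right: "c *\<^sub>C (x + y) = c *\<^sub>C x + c *\<^sub>C y"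
    and scaleC_add_left: "(c + d) *\<^sub>C x = c *\<^sub>C x + d *\<^sub>C x"
    and scaleC_scaleC: "c *\<^sub>C (d *\<^sub>C x) = (c * d) *\<^sub>C x"
    and scaleC_of_real: "complex_of_real r *\<^sub>C x = r *\<^sub>R x"
    and cinner_commute: "cinner x y = cnj (cinner y x)"
    and cinner_add_left: "cinner (x + y) z = cinner x z + cinner y z"
    and cinner_scaleC_left: "cinner (c *\<^sub>C x) y = c * cinner x y"
    and Re_cinner: "Re (cinner x y) = inner x y"

class chilbert_space = complex_inner + complete_space

global_interpretation complex_vector: vector_space "scaleC :: complex \<Rightarrow> 'a \<Rightarrow> 'a::complex_inner"
  defines csubspace = complex_vector.subspace
    and cspan = complex_vector.span
    and cdim = complex_vector.dim
proof
  show "1 *\<^sub>C x = x" for x :: 'a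
    using scaleC_of_real[of 1 x] by simp
qed (simp_all add: scaleC_add_right scaleC_add_left scaleC_scaleC)

instantiation complex :: chilbert_space
begin
definition scaleC_complex :: "complex \<Rightarrow> complex \<Rightarrow> complex"
  where "scaleC_complex c x = c * x"
definition cinner_complex :: "complex \<Rightarrow> complex \<Rightarrow> complex"
  where "cinner_complex x y = x * cnj y"
instance
  by standard
    (simp_all add: scaleC_complex_def cinner_complex_def algebra_simps scaleR_conv_of_real
      inner_complex_def)
end

instantiation prod :: (complex_inner, complex_inner) complex_inner
begin
definition scaleC_prod :: "complex \<Rightarrow> 'a \<times> 'b \<Rightarrow> 'a \<times> 'b"
  where "scaleC_prod c p = (c *\<^sub>C fst p, c *\<^sub>C snd p)"
definition cinner_prod :: "'a \<times> 'b \<Rightarrow> 'a \<times> 'b \<Rightarrow> complex"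
  where "cinner_prod p q = cinner (fst p) (fst q) + cinner (snd p) (snd q)"
instance
proof
  show "cinner p q = cnj (cinner q p)" for p q :: "'a \<times> 'b"
    unfolding cinner_prod_def complex_cnj_add
    by (simp only: cinner_commute[of "fst p"] cinner_commute[of "snd p"])
qed (auto simp: scaleC_prod_def cinner_prod_def prod_eq_iff scaleC_add_right scaleC_add_left
      scaleC_scaleC scaleC_of_real cinner_add_left cinner_scaleC_left Re_cinner
      inner_prod_def algebra_simps)
end

instance prod :: (chilbert_space, chilbert_space) chilbert_space ..

definition bounded_clinear :: "('a::complex_inner \<Rightarrow> 'b::complex_inner) \<Rightarrow> bool"
  where "bounded_clinear f \<longleftrightarrow> bounded_linear f \<and> (\<forall>c x. f (c *\<^sub>C x) = c *\<^sub>C f x)"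

definition clinear_on :: "'a::complex_inner set \<Rightarrow> ('a \<Rightarrow> 'b::complex_inner) \<Rightarrow> bool"
  where "clinear_on D f \<longleftrightarrow>
    (\<forall>x\<in>D. \<forall>y\<in>D. f (x + y) = f x + f y) \<and> (\<forall>c. \<forall>x\<in>D. f (c *\<^sub>C x) = c *\<^sub>C f x)"

definition cadjoint :: "('a::chilbert_space \<Rightarrow> 'b::chilbert_space) \<Rightarrow> 'b \<Rightarrow> 'a"
  where "cadjoint B = (SOME B'. \<forall>x y. cinner (B x) y = cinner x (B' y))"

definition orth_proj :: "'a::complex_inner set \<Rightarrow> 'a \<Rightarrow> 'a"
  where "orth_proj V x = (THE p. p \<in> V \<and> (\<forall>v\<in>V. cinner (x - p) v = 0))"


section \<open>Unbounded operators\<close>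

text \<open>
  An operator \<open>T\<close> in \<open>H\<close> with domain \<open>D(T)\<close> is represented by its graph
  \<open>{(u, T u) | u \<in> D(T)}\<close>. Thus \<open>D(T) = Domain T\<close> and extension of operators is inclusion
  of graphs.
\<close>

definition closed_dd_operator :: "('h::chilbert_space \<times> 'h) set \<Rightarrow> bool"
  where "closed_dd_operator T \<longleftrightarrow>
    csubspace T \<and> single_valued T \<and> closed T \<and> closure (Domain T) = UNIV"

definition op_adjoint :: "('h::chilbert_space \<times> 'h) set \<Rightarrow> ('h \<times> 'h) set"
  where "op_adjoint T = {(v, z). \<forall>(u, w)\<in>T. cinner w v = cinner u z}"

definition eigenspace :: "('h::chilbert_space \<times> 'h) set \<Rightarrow> complex \<Rightarrow> 'h set"
  where "eigenspace T \<mu> = {u. (u, \<mu> *\<^sub>C u) \<in> T}"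

text \<open>The value of \<open>(T - z)\<^sup>-\<^sup>1\<close> at \<open>f\<close>; meaningful only when \<open>T - z\<close> is a bijection
  \<open>D(T) \<rightarrow> H\<close>.\<close>

definition resolvent :: "('h::chilbert_space \<times> 'h) set \<Rightarrow> complex \<Rightarrow> 'h \<Rightarrow> 'h"
  where "resolvent T z f = (THE u. \<exists>w. (u, w) \<in> T \<and> w - z *\<^sub>C u = f)"

definition resolvent_set :: "('h::chilbert_space \<times> 'h) set \<Rightarrow> complex set"
  where "resolvent_set T = {z.
    (\<forall>f. \<exists>!u. \<exists>w. (u, w) \<in> T \<and> w - z *\<^sub>C u = f) \<and> bounded_clinear (resolvent T z)}"

definition spectrum :: "('h::chilbert_space \<times> 'h) set \<Rightarrow> complex set"
  where "spectrum T = - resolvent_set T"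


section \<open>Analytic operator-valued functions\<close>

text \<open>Complex differentiability with respect to the operator norm.\<close>

definition op_analytic_on ::
    "(complex \<Rightarrow> 'a::chilbert_space \<Rightarrow> 'b::chilbert_space) \<Rightarrow> complex set \<Rightarrow> bool"
  where "op_analytic_on F U \<longleftrightarrow> open U \<and> (\<forall>z\<in>U. bounded_clinear (F z)) \<and>
    (\<forall>z\<in>U. \<exists>D. bounded_clinear D \<and>
      ((\<lambda>w. onorm (\<lambda>x. inverse (w - z) *\<^sub>C (F w x - F z x) - D x)) \<longlongrightarrow> 0) (at z))"

text \<open>
  \<open>f\<close> is given on \<open>R\<close>, which need not be connected. A continuation of \<open>f\<close> is one single-valued
  analytic function \<open>F\<close> on a domain \<open>U\<close> that meets \<open>R\<close>; it has to agree with \<open>f\<close> on all of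
  \<open>U \<inter> R\<close>, and not merely on one component of this set.
\<close>

definition analytic_continuation ::
    "complex set \<Rightarrow> (complex \<Rightarrow> 'a::chilbert_space \<Rightarrow> 'b::chilbert_space) \<Rightarrow>
     complex set \<Rightarrow> (complex \<Rightarrow> 'a \<Rightarrow> 'b) \<Rightarrow> bool"
  where "analytic_continuation R f U F \<longleftrightarrow>
    connected U \<and> U \<inter> R \<noteq> {} \<and> op_analytic_on F U \<and> (\<forall>z\<in>U \<inter> R. F z = f z)"

definition point_of_analyticity ::
    "complex set \<Rightarrow> (complex \<Rightarrow> 'a::chilbert_space \<Rightarrow> 'b::chilbert_space) \<Rightarrow> complex \<Rightarrow> bool"
  where "point_of_analyticity R f z0 \<longleftrightarrow>
    (\<exists>U F. z0 \<in> U \<and> analytic_continuation R f U F) \<and>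
    (\<forall>U F V G. z0 \<in> U \<and> analytic_continuation R f U F \<and> z0 \<in> V \<and> analytic_continuation R f V G
       \<longrightarrow> (\<forall>\<^sub>F z in nhds z0. F z = G z))"


section \<open>Boundary triplets for adjoint pairs\<close>

text \<open>
  \<open>At\<close>, \<open>\<Gamma>t\<^sub>1\<close>, \<open>\<Gamma>t\<^sub>2\<close> stand for the objects usually decorated with a tilde.
  The boundary maps are total functions, of which only the values on \<open>D(At\<^sup>*)\<close>, respectively on
  \<open>D(A\<^sup>*)\<close>, matter. The norm of a pair \<open>(u, w)\<close> in a graph is the graph norm of \<open>u\<close>.
\<close>

locale adjoint_pair =
  fixes A At :: "('h::chilbert_space \<times> 'h) set"
  assumes A_op: "closed_dd_operator A"
    and At_op: "closed_dd_operator At"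
    and At_subset: "At \<subseteq> op_adjoint A"
    and A_subset: "A \<subseteq> op_adjoint At"

locale boundary_triplet = adjoint_pair A At
  for A At :: "('h::chilbert_space \<times> 'h) set" +
  fixes \<Gamma>\<^sub>1 :: "'h \<Rightarrow> 'p::chilbert_space" and \<Gamma>\<^sub>2 :: "'h \<Rightarrow> 'k::chilbert_space"
    and \<Gamma>t\<^sub>1 :: "'h \<Rightarrow> 'k" and \<Gamma>t\<^sub>2 :: "'h \<Rightarrow> 'p"
  assumes linear: "clinear_on (Domain (op_adjoint At)) \<Gamma>\<^sub>1"
      "clinear_on (Domain (op_adjoint At)) \<Gamma>\<^sub>2"
      "clinear_on (Domain (op_adjoint A)) \<Gamma>t\<^sub>1"
      "clinear_on (Domain (op_adjoint A)) \<Gamma>t\<^sub>2"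
    and bounded: "\<exists>C. \<forall>(u, w)\<in>op_adjoint At. norm (\<Gamma>\<^sub>1 u) \<le> C * norm (u, w)"
      "\<exists>C. \<forall>(u, w)\<in>op_adjoint At. norm (\<Gamma>\<^sub>2 u) \<le> C * norm (u, w)"
      "\<exists>C. \<forall>(v, z)\<in>op_adjoint A. norm (\<Gamma>t\<^sub>1 v) \<le> C * norm (v, z)"
      "\<exists>C. \<forall>(v, z)\<in>op_adjoint A. norm (\<Gamma>t\<^sub>2 v) \<le> C * norm (v, z)"
    and surj: "(\<lambda>u. (\<Gamma>\<^sub>1 u, \<Gamma>\<^sub>2 u)) ` Domain (op_adjoint At) = UNIV"
      "(\<lambda>v. (\<Gamma>t\<^sub>1 v, \<Gamma>t\<^sub>2 v)) ` Domain (op_adjoint A) = UNIV"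
    and domain_A: "Domain A = {u \<in> Domain (op_adjoint At). \<Gamma>\<^sub>1 u = 0 \<and> \<Gamma>\<^sub>2 u = 0}"
    and domain_At: "Domain At = {v \<in> Domain (op_adjoint A). \<Gamma>t\<^sub>1 v = 0 \<and> \<Gamma>t\<^sub>2 v = 0}"
    and green: "\<lbrakk>(u, w) \<in> op_adjoint At; (v, z) \<in> op_adjoint A\<rbrakk> \<Longrightarrow>
      cinner w v - cinner u z = cinner (\<Gamma>\<^sub>1 u) (\<Gamma>t\<^sub>2 v) - cinner (\<Gamma>\<^sub>2 u) (\<Gamma>t\<^sub>1 v)"

text \<open>
  In what follows \<open>T\<close> is a maximal operator with boundary maps \<open>G1\<close>, \<open>G2\<close>, to be instantiated
  both by \<open>At\<^sup>*, \<Gamma>\<^sub>1, \<Gamma>\<^sub>2, B\<close> and by \<open>A\<^sup>*, \<Gamma>t\<^sub>1, \<Gamma>t\<^sub>2, B\<^sup>*\<close>.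
\<close>

definition restriction ::
    "('h::chilbert_space \<times> 'h) set \<Rightarrow> ('h \<Rightarrow> 'p::chilbert_space) \<Rightarrow> ('h \<Rightarrow> 'k::chilbert_space) \<Rightarrow>
     ('k \<Rightarrow> 'p) \<Rightarrow> ('h \<times> 'h) set"
  where "restriction T G1 G2 B = {(u, w) \<in> T. G1 u - B (G2 u) = 0}"

text \<open>
  By surjectivity of \<open>(\<Gamma>\<^sub>1, \<Gamma>\<^sub>2)\<close>, the range of \<open>\<Gamma>\<^sub>1 - B \<Gamma>\<^sub>2\<close> is the whole boundary space,
  so \<open>M_function T G1 G2 B z\<close> is meaningful everywhere for \<open>z\<close> in the resolvent set.
\<close>

definition M_function ::
    "('h::chilbert_space \<times> 'h) set \<Rightarrow> ('h \<Rightarrow> 'p::chilbert_space) \<Rightarrow> ('h \<Rightarrow> 'k::chilbert_space) \<Rightarrow>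
     ('k \<Rightarrow> 'p) \<Rightarrow> complex \<Rightarrow> 'p \<Rightarrow> 'k"
  where "M_function T G1 G2 B z f =
    (THE k. \<exists>u\<in>eigenspace T z. G1 u - B (G2 u) = f \<and> G2 u = k)"

lemma (in boundary_triplet) range_boundary_map:
  assumes "bounded_clinear B"
  shows "(\<lambda>u. \<Gamma>\<^sub>1 u - B (\<Gamma>\<^sub>2 u)) ` Domain (op_adjoint At) = UNIV"
proof -
  have B0: "B 0 = 0"
    using assms by (simp add: bounded_clinear_def bounded_linear.linear linear_0)
  have "f \<in> (\<lambda>u. \<Gamma>\<^sub>1 u - B (\<Gamma>\<^sub>2 u)) ` Domain (op_adjoint At)" for f
  proof -
    have "(f, 0) \<in> (\<lambda>u. (\<Gamma>\<^sub>1 u, \<Gamma>\<^sub>2 u)) ` Domain (op_adjoint At)"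
      by (simp add: surj(1))
    then obtain u where "u \<in> Domain (op_adjoint At)" "\<Gamma>\<^sub>1 u = f" "\<Gamma>\<^sub>2 u = 0"
      unfolding image_iff by (metis Pair_inject)
    then show ?thesis
      using B0 by (intro image_eqI[of _ _ u]) simp_all
  qed
  then show ?thesis by auto
qed

definition solution_op ::
    "('h::chilbert_space \<times> 'h) set \<Rightarrow> ('h \<Rightarrow> 'p::chilbert_space) \<Rightarrow> ('h \<Rightarrow> 'k::chilbert_space) \<Rightarrow>
     ('k \<Rightarrow> 'p) \<Rightarrow> complex \<Rightarrow> 'p \<Rightarrow> 'h"
  where "solution_op T G1 G2 B \<mu> = inv_into (eigenspace T \<mu>) (\<lambda>u. G1 u - B (G2 u))"

definition ran_solution_op ::
    "('h::chilbert_space \<times> 'h) set \<Rightarrow> ('h \<Rightarrow> 'p::chilbert_space) \<Rightarrow> ('h \<Rightarrow> 'k::chilbert_space) \<Rightarrow>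
     ('k \<Rightarrow> 'p) \<Rightarrow> complex \<Rightarrow> 'h set"
  where "ran_solution_op T G1 G2 B \<mu> =
    solution_op T G1 G2 B \<mu> ` (\<lambda>u. G1 u - B (G2 u)) ` eigenspace T \<mu>"

definition S_space ::
    "('h::chilbert_space \<times> 'h) set \<Rightarrow> ('h \<Rightarrow> 'p::chilbert_space) \<Rightarrow> ('h \<Rightarrow> 'k::chilbert_space) \<Rightarrow>
     ('k \<Rightarrow> 'p) \<Rightarrow> complex \<Rightarrow> 'h set"
  where "S_space T G1 G2 B \<mu> =
    cspan (\<Union>\<delta>\<in>- spectrum (restriction T G1 G2 B).
      resolvent (restriction T G1 G2 B) \<delta> ` ran_solution_op T G1 G2 B \<mu>)"

definition T_space ::
    "('h::chilbert_space \<times> 'h) set \<Rightarrow> ('h \<Rightarrow> 'p::chilbert_space) \<Rightarrow> ('h \<Rightarrow> 'k::chilbert_space) \<Rightarrow>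
     ('k \<Rightarrow> 'p) \<Rightarrow> 'h set"
  where "T_space T G1 G2 B =
    cspan (\<Union>\<mu>\<in>- spectrum (restriction T G1 G2 B). ran_solution_op T G1 G2 B \<mu>)"

end

theory Submission
  imports Defs "HOL-Complex_Analysis.Complex_Analysis"
begin

text \<open>
  For \<open>d\<close> in the kernel of \<open>At\<^sup>* - \<mu>\<close> and \<open>e\<close> in the kernel of \<open>A\<^sup>* - \<nu>\<close>, Green's identity expresses
  \<open>((A\<^sub>B - z)\<^sup>-\<^sup>1 d, e)\<close> rationally, with poles at most at \<open>\<mu>\<close> and \<open>cnj \<nu>\<close>, through \<open>(M\<^sub>B z f, k)\<close> with
  fixed boundary vectors \<open>f\<close>, \<open>k\<close>. If \<open>z\<^sub>0\<close> lies in the spectrum of \<open>A\<^sub>B\<close> it differs from \<open>\<mu>\<close>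
  and from \<open>cnj \<nu>\<close>, because \<open>A\<^sub>B\<close> is the adjoint of \<open>At\<^sub>B\<close>; so the continuation of \<open>M\<^sub>B\<close> continues
  this function, and the resolvent identity carries this over to resolvents of \<open>d\<close> and \<open>e\<close>. If \<open>z\<^sub>0\<close>
  is in the resolvent set there is nothing to continue. A compression to finite-dimensional
  subspaces is a finite sum of such matrix elements. Uniqueness of the continuation follows from
  the identity theorem, as \<open>z\<^sub>0\<close> is in the closure of the open resolvent set.
\<close>

section \<open>Complex inner product spaces\<close>

lemma cinner_add_right: "cinner x (y + z) = cinner x y + cinner x z"
  by (subst (1 2 3) cinner_commute) (simp add: cinner_add_left)

lemma cinner_scaleC_right: "cinner x (c *\<^sub>C y) = cnj c * cinner x y"
  by (subst (1 2) cinner_commute) (simp add: cinner_scaleC_left)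

lemma cinner_zero_left [simp]: "cinner 0 x = 0"
  using cinner_add_left[of 0 0 x] by simp

lemma cinner_zero_right [simp]: "cinner x 0 = 0"
  using cinner_add_right[of x 0 0] by simp

lemma cinner_minus_left: "cinner (- x) y = - cinner x y"
  using cinner_add_left[of x "- x" y] by (simp add: eq_neg_iff_add_eq_0 add.commute)

lemma cinner_minus_right: "cinner x (- y) = - cinner x y"
  using cinner_add_right[of x y "- y"] by (simp add: eq_neg_iff_add_eq_0 add.commute)

lemma cinner_diff_left: "cinner (x - y) z = cinner x z - cinner y z"
  using cinner_add_left[of x "- y" z] by (simp add: cinner_minus_left)

lemma cinner_diff_right: "cinner x (y - z) = cinner x y - cinner x z"
  using cinner_add_right[of x y "- z"] by (simp add: cinner_minus_right)

lemma cinner_sum_left: "cinner (sum f I) y = (\<Sum>i\<in>I. cinner (f i) y)"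
  by (induction I rule: infinite_finite_induct) (simp_all add: cinner_add_left)

lemma cinner_swap_eq: "cinner x y = cinner u v \<Longrightarrow> cinner y x = cinner v u"
  by (subst (1 2) cinner_commute) simp

lemma cinner_self: "cinner x x = complex_of_real ((norm x)\<^sup>2)"
proof (rule complex_eqI)
  show "Re (cinner x x) = Re (complex_of_real ((norm x)\<^sup>2))"
    by (simp add: Re_cinner power2_norm_eq_inner del: of_real_power)
  have "Im (cinner x x) = - Im (cinner x x)"
    by (subst cinner_commute) simp
  then show "Im (cinner x x) = Im (complex_of_real ((norm x)\<^sup>2))"
    by (simp del: of_real_power)
qed

lemma cinner_self_eq_zero_iff: "cinner x x = 0 \<longleftrightarrow> x = 0"
  by (simp add: cinner_self)

text \<open>The class axioms relate the norm directly only to real scalars. Complex homogeneity is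
  read off from the inner product of the scaled vector with itself, since c times its conjugate is
  the squared modulus.\<close>

lemma norm_scaleC: "norm (c *\<^sub>C x) = cmod c * norm x"
proof -
  have "cinner (c *\<^sub>C x) (c *\<^sub>C x) = (c * cnj c) * cinner x x"
    by (simp add: cinner_scaleC_left cinner_scaleC_right)
  then have "complex_of_real ((norm (c *\<^sub>C x))\<^sup>2) = complex_of_real ((cmod c * norm x)\<^sup>2)"
    by (simp add: cinner_self complex_norm_square[symmetric] power_mult_distrib)
  then have "(norm (c *\<^sub>C x))\<^sup>2 = (cmod c * norm x)\<^sup>2"
    by (simp only: of_real_eq_iff)
  then show ?thesis
    by (simp add: power2_eq_iff_nonneg)
qed

text \<open>The real Cauchy-Schwarz inequality controls only the real part. Multiplying
  \<open>x\<close> by the conjugate phase of \<open>cinner x y\<close> makes the inner product real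
  and nonnegative without changing the norm of \<open>x\<close>.\<close>

lemma norm_cinner_le: "cmod (cinner x y) \<le> norm x * norm y"
proof (cases "cinner x y = 0")
  case False
  define c where "c = cnj (sgn (cinner x y))"
  have "cmod c = 1"
    using False by (simp add: c_def norm_sgn)
  have "cinner (c *\<^sub>C x) y = complex_of_real (cmod (cinner x y))"
    using False
    by (simp add: c_def cinner_scaleC_left sgn_div_norm scaleR_conv_of_real field_simps
        complex_norm_square[symmetric] power2_eq_square flip: of_real_mult)
  then have "cmod (cinner x y) = inner (c *\<^sub>C x) y"
    using Re_cinner[of "c *\<^sub>C x" y] by simp
  also have "\<dots> \<le> norm (c *\<^sub>C x) * norm y"
    by (rule norm_cauchy_schwarz)
  finally show ?thesis
    using \<open>cmod c = 1\<close> by (simp add: norm_scaleC)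
qed simp

section \<open>Bounded complex-linear maps\<close>

lemma bounded_clinearI:
  assumes "\<And>x y. f (x + y) = f x + f y" "\<And>c x. f (c *\<^sub>C x) = c *\<^sub>C f x"
    and "\<And>x. norm (f x) \<le> norm x * K"
  shows "bounded_clinear f"
  unfolding bounded_clinear_def
proof (intro conjI allI bounded_linear_intro)
  show "f (r *\<^sub>R x) = r *\<^sub>R f x" for r x
    using assms(2)[of "complex_of_real r" x] by (simp add: scaleC_of_real)
qed (use assms in auto)

lemma
  assumes "bounded_clinear f"
  shows bounded_clinear_add: "f (x + y) = f x + f y"
    and bounded_clinear_diff: "f (x - y) = f x - f y"
    and bounded_clinear_zero: "f 0 = 0"
    and bounded_clinear_scaleC: "f (c *\<^sub>C x) = c *\<^sub>C f x"
  using assms unfolding bounded_clinear_def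
  by (auto simp: linear_simps bounded_linear.linear linear_0)

lemma bounded_clinear_bound:
  assumes "bounded_clinear f"
  obtains K where "K > 0" "\<And>x. norm (f x) \<le> norm x * K"
  using assms bounded_linear.pos_bounded unfolding bounded_clinear_def by blast

lemma bounded_linear_scaleC_right: "bounded_linear (\<lambda>x. c *\<^sub>C x)"
proof (rule bounded_linear_intro)
  show "c *\<^sub>C r *\<^sub>R x = r *\<^sub>R c *\<^sub>C x" for r and x :: 'a
    by (metis scaleC_of_real scaleC_scaleC mult.commute)
  show "norm (c *\<^sub>C x) \<le> norm x * cmod c" for x :: 'a
    by (simp add: norm_scaleC)
qed (rule scaleC_add_right)


section \<open>Riesz representation and adjoints\<close>

text \<open>The representing vector is the minimiser of \<open>\<parallel>x\<parallel>\<^sup>2 - 2 f x\<close>; minimising sequences are Cauchy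
  by the parallelogram law.\<close>

lemma riesz_representation:
  fixes f :: "'a::{real_inner, complete_space} \<Rightarrow> real"
  assumes f: "bounded_linear f"
  shows "\<exists>y. \<forall>x. f x = inner x y"
proof -
  interpret bounded_linear f by fact
  define J where "J x = (norm x)\<^sup>2 - 2 * f x" for x
  obtain K where K: "\<And>x. norm (f x) \<le> norm x * K"
    using bounded by blast
  \<comment> \<open>Completing the square in \<open>norm x - K\<close> shows that \<open>J\<close>
    is bounded below, so that its infimum is finite.\<close>
  have "- (K\<^sup>2) \<le> J x" for x
  proof -
    have "f x \<le> norm x * K"
      using K[of x] by simp
    then have "(norm x - K)\<^sup>2 - K\<^sup>2 \<le> J x"
      by (simp add: J_def power2_eq_square algebra_simps)
    then show ?thesis
      by (smt (verit) zero_le_power2)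
  qed
  then have bdd: "bdd_below (range J)"
    by (intro bdd_belowI2)
  define m where "m = Inf (range J)"
  have m_le: "m \<le> J x" for x
    unfolding m_def using bdd by (auto intro: cInf_lower)
  have "\<exists>x. J x < m + 1 / real (Suc n)" for n
    using cInf_lessD[of "range J" "m + 1 / real (Suc n)"] by (auto simp: m_def)
  then obtain X where X: "\<And>n. J (X n) < m + 1 / real (Suc n)"
    by metis
  \<comment> \<open>Since \<open>f\<close> is linear, its contributions at \<open>x\<close>,
    \<open>y\<close> and their midpoint cancel, and the parallelogram law for norms becomes one for
    \<open>J\<close>.\<close>
  have parallelogram: "(norm (x - y))\<^sup>2 = 2 * J x + 2 * J y - 4 * J ((1/2) *\<^sub>R (x + y))" for x y
  proof -
    have "(norm (x - y))\<^sup>2 + (norm (x + y))\<^sup>2 = 2 * (norm x)\<^sup>2 + 2 * (norm y)\<^sup>2"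
      by (simp add: power2_norm_eq_inner inner_simps inner_commute)
    moreover have "4 * (norm ((1/2) *\<^sub>R (x + y)))\<^sup>2 = (norm (x + y))\<^sup>2"
      by (simp add: power_mult_distrib power2_eq_square del: scaleR_add_right)
    moreover have "f ((1/2) *\<^sub>R (x + y)) = (f x + f y) / 2"
      by (simp only: add scaleR) simp
    ultimately show ?thesis
      unfolding J_def by argo
  qed
  have "Cauchy X"
  proof (rule metric_CauchyI)
    fix e :: real assume "e > 0"
    \<comment> \<open>Two values of \<open>J\<close> within 1/(N+1) of the infimum, with the
      midpoint value at least the infimum, give a squared distance below 4/(N+1).\<close>
    then obtain N where N: "4 / real (Suc N) < e\<^sup>2"
      using reals_Archimedean[of "e\<^sup>2 / 4"] by (auto simp: field_simps)
    have "dist (X i) (X j) < e" if "N \<le> i" "N \<le> j" for i j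
    proof -
      have "1 / real (Suc i) \<le> 1 / real (Suc N)" "1 / real (Suc j) \<le> 1 / real (Suc N)"
        using that by (auto simp: field_simps)
      then have "(norm (X i - X j))\<^sup>2 < 4 / real (Suc N)"
        using X[of i] X[of j] m_le[of "(1/2) *\<^sub>R (X i + X j)"] parallelogram[of "X i" "X j"]
        by linarith
      then show ?thesis
        using N \<open>e > 0\<close> by (smt (verit) dist_norm power2_le_imp_le)
    qed
    then show "\<exists>N. \<forall>i\<ge>N. \<forall>j\<ge>N. dist (X i) (X j) < e"
      by blast
  qed
  then obtain y where y: "X \<longlonglongrightarrow> y"
    using Cauchy_convergent convergentD by blast
  have "(\<lambda>n. J (X n)) \<longlonglongrightarrow> J y"
    unfolding J_def by (intro tendsto_intros y tendsto)
  moreover have "(\<lambda>n. m + 1 / real (Suc n)) \<longlonglongrightarrow> m"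
    using tendsto_add[OF tendsto_const LIMSEQ_inverse_real_of_nat, of m]
    by (simp add: inverse_eq_divide)
  ultimately have "J y \<le> m"
    by (rule LIMSEQ_le) (use X less_imp_le in blast)
  have "f h = inner h y" for h
  proof (rule ccontr)
    assume neq: "f h \<noteq> inner h y"
    define a where "a = inner h y - f h"
    have "a \<noteq> 0" using neq by (simp add: a_def)
    then have "h \<noteq> 0" by (auto simp: a_def zero)
    \<comment> \<open>The minimiser of the quadratic increment 2ta + t^2 |h|^2 of \<open>J\<close>
      along \<open>h\<close>; at this t the increment is negative, contradicting minimality of
      \<open>J y\<close>.\<close>
    define t where "t = - a / (norm h)\<^sup>2"
    have "J (y + t *\<^sub>R h) = J y + 2 * t * a + t\<^sup>2 * (norm h)\<^sup>2"
    proof -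
      have "(norm (y + t *\<^sub>R h))\<^sup>2 = (norm y)\<^sup>2 + 2 * t * inner h y + t\<^sup>2 * (norm h)\<^sup>2"
        unfolding power2_norm_eq_inner
        by (simp add: inner_add_left inner_add_right inner_commute[of y h] power2_eq_square
            distrib_left)
      then show ?thesis
        by (simp add: J_def add scaleR a_def right_diff_distrib)
    qed
    also have "\<dots> = J y - a\<^sup>2 / (norm h)\<^sup>2"
      using \<open>h \<noteq> 0\<close> by (simp add: t_def power2_eq_square field_simps)
    also have "\<dots> < J y"
      using \<open>a \<noteq> 0\<close> \<open>h \<noteq> 0\<close> by simp
    finally show False
      using m_le[of "y + t *\<^sub>R h"] \<open>J y \<le> m\<close> by simp
  qed
  then show ?thesis by blast
qed

text \<open>\<open>cadjoint\<close> is a choice, so it suffices that some adjoint exists. Riesz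
  representation supplies it for the real inner products, and replacing \<open>x\<close> by -i times
  \<open>x\<close> extends the identity from real to imaginary parts.\<close>

lemma cadjoint_cinner:
  fixes B :: "'a::chilbert_space \<Rightarrow> 'b::chilbert_space"
  assumes B: "bounded_clinear B"
  shows "cinner (B x) y = cinner x (cadjoint B y)"
proof -
  have "\<exists>z. \<forall>x. inner (B x) y = inner x z" for y
  proof (rule riesz_representation)
    show "bounded_linear (\<lambda>x. inner (B x) y)"
      using B bounded_linear_compose[OF bounded_linear_inner_left]
      unfolding bounded_clinear_def by blast
  qed
  then obtain B' where B': "\<And>x y. inner (B x) y = inner x (B' y)"
    by metis
  have "cinner (B x) y = cinner x (B' y)" for x y
  proof (rule complex_eqI)
    show "Re (cinner (B x) y) = Re (cinner x (B' y))"
      by (simp add: Re_cinner B')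
    have "Re (cinner (B ((- \<i>) *\<^sub>C x)) y) = Re (cinner ((- \<i>) *\<^sub>C x) (B' y))"
      by (simp only: Re_cinner B')
    then show "Im (cinner (B x) y) = Im (cinner x (B' y))"
      by (simp add: bounded_clinear_scaleC[OF B] cinner_scaleC_left
          del: complex_vector.scale_minus_left)
  qed
  then have "\<exists>B'. \<forall>x y. cinner (B x) y = cinner x (B' y)"
    by blast
  from someI_ex[OF this] show ?thesis
    unfolding cadjoint_def by blast
qed

lemma cinner_eq_imp_eq:
  assumes "\<And>x. cinner x y = cinner x z"
  shows "y = z"
proof -
  have "cinner (y - z) (y - z) = 0"
    using assms[of "y - z"] by (simp add: cinner_diff_right)
  then show ?thesis
    by (simp add: cinner_self_eq_zero_iff)
qed

text \<open>Linearity follows because a vector is determined by its inner products. For the bound,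
  the squared norm of the adjoint's value at \<open>y\<close> is the inner product of its image
  under \<open>B\<close> with \<open>y\<close>, and one factor of its norm is cancelled.\<close>

lemma bounded_clinear_cadjoint:
  fixes B :: "'a::chilbert_space \<Rightarrow> 'b::chilbert_space"
  assumes B: "bounded_clinear B"
  shows "bounded_clinear (cadjoint B)"
proof -
  obtain K where "K > 0" and K: "\<And>x. norm (B x) \<le> norm x * K"
    using B bounded_clinear_bound by blast
  note adj = cadjoint_cinner[OF B, symmetric]
  show ?thesis
  proof (rule bounded_clinearI)
    show "cadjoint B (x + y) = cadjoint B x + cadjoint B y" for x y
      by (rule cinner_eq_imp_eq) (simp add: adj cinner_add_right)
    show "cadjoint B (c *\<^sub>C x) = c *\<^sub>C cadjoint B x" for c x
      by (rule cinner_eq_imp_eq) (simp add: adj cinner_scaleC_right)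
    show "norm (cadjoint B y) \<le> norm y * K" for y
    proof (cases "cadjoint B y = 0")
      case True
      then show ?thesis using \<open>K > 0\<close> by simp
    next
      case False
      have "complex_of_real ((norm (cadjoint B y))\<^sup>2) = cinner (B (cadjoint B y)) y"
        by (metis adj cinner_self)
      then have "(norm (cadjoint B y))\<^sup>2 \<le> norm (B (cadjoint B y)) * norm y"
        by (metis norm_cinner_le norm_of_real abs_of_nonneg zero_le_power2)
      also have "\<dots> \<le> norm (cadjoint B y) * K * norm y"
        by (rule mult_right_mono[OF K]) simp
      finally show ?thesis
        using False by (simp add: power2_eq_square mult.assoc mult.commute)
    qed
  qed
qed


section \<open>Resolvents\<close>

lemma resolvent_unique:
  assumes z: "z \<in> resolvent_set T" and "(u, w) \<in> T" "w - z *\<^sub>C u = f"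
  shows "resolvent T z f = u"
proof -
  have "\<exists>!u. \<exists>w. (u, w) \<in> T \<and> w - z *\<^sub>C u = f"
    using z by (simp add: resolvent_set_def)
  then show ?thesis
    unfolding resolvent_def by (rule the1_equality) (use assms in blast)
qed

lemma resolvent_mem:
  assumes z: "z \<in> resolvent_set T"
  shows "(resolvent T z f, f + z *\<^sub>C resolvent T z f) \<in> T"
proof -
  have "\<exists>!u. \<exists>w. (u, w) \<in> T \<and> w - z *\<^sub>C u = f"
    using z by (auto simp: resolvent_set_def)
  then have "\<exists>w. (resolvent T z f, w) \<in> T \<and> w - z *\<^sub>C resolvent T z f = f"
    unfolding resolvent_def by (rule theI')
  then obtain w where w: "(resolvent T z f, w) \<in> T" "w - z *\<^sub>C resolvent T z f = f"
    by blast
  from w(2) have "w = f + z *\<^sub>C resolvent T z f"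
    by (simp only: diff_eq_eq)
  with w(1) show ?thesis
    by (simp only:)
qed

lemma bounded_clinear_resolvent: "z \<in> resolvent_set T \<Longrightarrow> bounded_clinear (resolvent T z)"
  by (simp add: resolvent_set_def)

text \<open>For u the value of the resolvent at \<open>d\<close>, (T - z) u = f - (z - d) u.
  Applying the resolvent at \<open>z\<close> to this equation and using its linearity gives the
  identity.\<close>

lemma resolvent_identity:
  assumes z: "z \<in> resolvent_set T" and d: "d \<in> resolvent_set T"
  shows "resolvent T z f - resolvent T d f = (z - d) *\<^sub>C resolvent T z (resolvent T d f)"
proof -
  let ?u = "resolvent T d f"
  note R = bounded_clinear_resolvent[OF z]
  have "resolvent T z (f + d *\<^sub>C ?u - z *\<^sub>C ?u) = ?u"
    by (rule resolvent_unique[OF z resolvent_mem[OF d] refl])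
  moreover have "f + d *\<^sub>C ?u - z *\<^sub>C ?u = f - (z - d) *\<^sub>C ?u"
    by (simp add: complex_vector.scale_left_diff_distrib)
  ultimately show ?thesis
    by (simp only: bounded_clinear_diff[OF R] bounded_clinear_scaleC[OF R] diff_eq_eq) simp
qed

text \<open>For \<open>z\<close> near \<open>d\<close>, the equation \<open>(T - z) u = f\<close> is the fixed point equation
  \<open>u = (T - d)\<^sup>-\<^sup>1 (f + (z - d) u)\<close> of a contraction.\<close>

lemma resolvent_perturbation:
  fixes T :: "('h::chilbert_space \<times> 'h) set"
  assumes d: "d \<in> resolvent_set T"
  obtains r K where "r > 0" "K > 0" "ball d r \<subseteq> resolvent_set T"
    "\<And>z f. z \<in> ball d r \<Longrightarrow> norm (resolvent T z f) \<le> norm f * K"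
proof -
  let ?R = "resolvent T d"
  note R = bounded_clinear_resolvent[OF d]
  obtain L where "L > 0" and L: "\<And>f. norm (?R f) \<le> norm f * L"
    using bounded_clinear_bound[OF R] by blast
  \<comment> \<open>On this ball the map u to R (z - d) u has norm at most 1/2. This gives the
    contraction, and the resolvent bound 2L follows by absorbing half of the norm of the
    solution.\<close>
  define r where "r = 1 / (2 * L)"
  have "r > 0" using \<open>L > 0\<close> by (simp add: r_def)
  have main: "z \<in> resolvent_set T \<and> (\<forall>f. norm (resolvent T z f) \<le> norm f * (2 * L))"
    if z: "z \<in> ball d r" for z
  proof -
    have q: "cmod (z - d) * L \<le> 1 / 2"
      using z \<open>L > 0\<close> by (simp add: r_def dist_norm norm_minus_commute field_simps)
    define \<phi> where "\<phi> f u = ?R (f + (z - d) *\<^sub>C u)" for f u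
    have \<phi>: "\<phi> f u = ?R f + (z - d) *\<^sub>C ?R u" for f u
      by (simp add: \<phi>_def bounded_clinear_add[OF R] bounded_clinear_scaleC[OF R])
    have small: "norm ((z - d) *\<^sub>C ?R u) \<le> 1 / 2 * norm u" for u
    proof -
      have "norm ((z - d) *\<^sub>C ?R u) \<le> cmod (z - d) * (norm u * L)"
        unfolding norm_scaleC by (intro mult_left_mono L) simp
      also have "\<dots> \<le> 1 / 2 * norm u"
        using mult_right_mono[OF q norm_ge_zero[of u]] by (simp add: algebra_simps)
      finally show ?thesis .
    qed
    have fix1: "\<exists>!u. \<phi> f u = u" for f
    proof (rule banach_fix_type)
      show "\<forall>u v. dist (\<phi> f u) (\<phi> f v) \<le> 1 / 2 * dist u v"
        using small[of "u - v" for u v]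
        by (simp only: \<phi> dist_norm bounded_clinear_diff[OF R] add_diff_cancel_left
            complex_vector.scale_right_diff_distrib) simp
    qed auto
    \<comment> \<open>Translates solvability of (T - z) u = f into a fixed point equation, so that
      existence and uniqueness are both supplied by the contraction principle.\<close>
    have eqv: "(\<exists>w. (u, w) \<in> T \<and> w - z *\<^sub>C u = f) \<longleftrightarrow> \<phi> f u = u" for f u
    proof
      assume "\<exists>w. (u, w) \<in> T \<and> w - z *\<^sub>C u = f"
      then obtain w where w: "(u, w) \<in> T" "w - z *\<^sub>C u = f" by blast
      show "\<phi> f u = u"
        unfolding \<phi>_def
        by (rule resolvent_unique[OF d w(1)])
          (use w(2) in \<open>auto simp: complex_vector.scale_left_diff_distrib algebra_simps\<close>)
    next
      assume "\<phi> f u = u"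
      then have "(u, f + (z - d) *\<^sub>C u + d *\<^sub>C u) \<in> T"
        using resolvent_mem[OF d, of "f + (z - d) *\<^sub>C u"] by (simp add: \<phi>_def)
      then show "\<exists>w. (u, w) \<in> T \<and> w - z *\<^sub>C u = f"
        by (rule_tac exI) (auto simp: complex_vector.scale_left_diff_distrib)
    qed
    let ?U = "resolvent T z"
    have U: "?U f = (THE u. \<phi> f u = u)" for f
      by (simp add: resolvent_def eqv)
    have \<phi>U: "\<phi> f (?U f) = ?U f" for f
      unfolding U by (rule theI'[OF fix1])
    have UI: "?U f = u" if "\<phi> f u = u" for f u
      using fix1[of f] that \<phi>U[of f] by blast
    have bound: "norm (?U f) \<le> norm f * (2 * L)" for f
    proof -
      have "norm (?U f) \<le> norm (?R f) + norm ((z - d) *\<^sub>C ?R (?U f))"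
        by (metis \<phi> \<phi>U norm_triangle_ineq)
      also have "\<dots> \<le> norm f * L + 1 / 2 * norm (?U f)"
        by (intro add_mono L small)
      finally show ?thesis by simp
    qed
    \<comment> \<open>Sums and multiples of fixed points solve the fixed point equations for the
      corresponding right-hand sides; uniqueness then makes the solution map linear.\<close>
    have "bounded_clinear ?U"
    proof (rule bounded_clinearI)
      show "?U (f + g) = ?U f + ?U g" for f g
      proof (intro UI)
        have "\<phi> (f + g) (?U f + ?U g) = \<phi> f (?U f) + \<phi> g (?U g)"
          by (simp add: \<phi> bounded_clinear_add[OF R] scaleC_add_right add_ac)
        then show "\<phi> (f + g) (?U f + ?U g) = ?U f + ?U g"
          by (simp only: \<phi>U)
      qed
      show "?U (c *\<^sub>C f) = c *\<^sub>C ?U f" for c f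
      proof (intro UI)
        have "\<phi> (c *\<^sub>C f) (c *\<^sub>C ?U f) = c *\<^sub>C \<phi> f (?U f)"
          by (simp add: \<phi> bounded_clinear_scaleC[OF R] scaleC_add_right scaleC_scaleC mult.commute)
        then show "\<phi> (c *\<^sub>C f) (c *\<^sub>C ?U f) = c *\<^sub>C ?U f"
          by (simp only: \<phi>U)
      qed
    qed (rule bound)
    then show ?thesis
      using bound fix1 by (simp add: resolvent_set_def eqv)
  qed
  show ?thesis
  proof (rule that[of r "2 * L"])
    show "ball d r \<subseteq> resolvent_set T"
      using main by blast
  qed (use main \<open>r > 0\<close> \<open>L > 0\<close> in auto)
qed

lemma open_resolvent_set: "open (resolvent_set T)"
  unfolding open_contains_ball by (meson resolvent_perturbation)

text \<open>Using the resolvent identity twice, the difference quotient minus the expected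
  derivative equals (z - d) times a matrix element of R(z) R(d) R(d). The locally uniform bound on
  R(z) makes this tend to 0.\<close>

lemma holomorphic_resolvent:
  fixes T :: "('h::chilbert_space \<times> 'h) set"
  shows "(\<lambda>z. cinner (resolvent T z x) y) holomorphic_on resolvent_set T"
proof -
  let ?R = "resolvent T"
  have "((\<lambda>z. cinner (?R z x) y) has_field_derivative cinner (?R d (?R d x)) y) (at d)"
    if d: "d \<in> resolvent_set T" for d
  proof -
    obtain r K where "r > 0" "K > 0" and ball: "ball d r \<subseteq> resolvent_set T"
      and K: "\<And>z f. z \<in> ball d r \<Longrightarrow> norm (?R z f) \<le> norm f * K"
      using resolvent_perturbation[OF d] by metis
    define v where "v = ?R d (?R d x)"
    define C where "C = norm v * K * norm y"
    have near: "\<forall>\<^sub>F z in at d. z \<in> ball d r \<and> z \<noteq> d"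
      using \<open>r > 0\<close> by (intro eventually_conj eventually_at_in_open' eventually_neq_at_within) auto
    have "((\<lambda>z. (cinner (?R z x) y - cinner (?R d x) y) / (z - d) - cinner v y) \<longlongrightarrow> 0) (at d)"
    proof (rule Lim_null_comparison)
      show "\<forall>\<^sub>F z in at d.
          norm ((cinner (?R z x) y - cinner (?R d x) y) / (z - d) - cinner v y) \<le> cmod (z - d) * C"
        using near
      proof eventually_elim
        case (elim z)
        then have z: "z \<in> resolvent_set T" and "z \<noteq> d" using ball by auto
        have "(cinner (?R z x) y - cinner (?R d x) y) / (z - d) - cinner v y
            = cinner (?R z (?R d x) - ?R d (?R d x)) y"
        proof -
          have "cinner (?R z x) y - cinner (?R d x) y = (z - d) * cinner (?R z (?R d x)) y"
            by (simp only: cinner_diff_left[symmetric] resolvent_identity[OF z d] cinner_scaleC_left)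
          then show ?thesis
            using \<open>z \<noteq> d\<close> by (simp add: v_def cinner_diff_left)
        qed
        also have "\<dots> = (z - d) * cinner (?R z v) y"
          by (simp add: resolvent_identity[OF z d] cinner_scaleC_left v_def)
        finally have "norm ((cinner (?R z x) y - cinner (?R d x) y) / (z - d) - cinner v y)
            = cmod (z - d) * cmod (cinner (?R z v) y)"
          by (simp add: norm_mult)
        also have "\<dots> \<le> cmod (z - d) * C"
          unfolding C_def using K[of z v] elim
          by (intro mult_left_mono order_trans[OF norm_cinner_le] mult_right_mono) auto
        finally show ?case .
      qed
      show "((\<lambda>z. cmod (z - d) * C) \<longlongrightarrow> 0) (at d)"
        by (auto intro!: tendsto_eq_intros)
    qed
    then show ?thesis
      unfolding has_field_derivative_iff v_def by (simp add: LIM_zero_iff)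
  qed
  then show ?thesis
    by (auto intro!: holomorphic_on_open[THEN iffD2] open_resolvent_set)
qed


section \<open>Analytic operator-valued functions\<close>

text \<open>Differentiability in operator norm implies weak differentiability: the scalar remainder
  is at most the operator norm of the remainder times the norms of \<open>x\<close> and
  \<open>y\<close>.\<close>

lemma holomorphic_cinner_op_analytic:
  assumes "op_analytic_on F U"
  shows "(\<lambda>z. cinner (F z x) y) holomorphic_on U"
proof -
  have "open U" and lin: "\<And>z. z \<in> U \<Longrightarrow> bounded_clinear (F z)"
    using assms by (auto simp: op_analytic_on_def)
  have "\<exists>c. ((\<lambda>w. cinner (F w x) y) has_field_derivative c) (at z)" if "z \<in> U" for z
  proof -
    obtain D where D: "bounded_clinear D"
      and lim: "((\<lambda>w. onorm (\<lambda>x. inverse (w - z) *\<^sub>C (F w x - F z x) - D x)) \<longlongrightarrow> 0) (at z)"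
      using assms \<open>z \<in> U\<close> unfolding op_analytic_on_def by blast
    let ?Q = "\<lambda>w x. inverse (w - z) *\<^sub>C (F w x - F z x) - D x"
    have "((\<lambda>w. (cinner (F w x) y - cinner (F z x) y) / (w - z) - cinner (D x) y) \<longlongrightarrow> 0) (at z)"
    proof (rule Lim_null_comparison)
      show "\<forall>\<^sub>F w in at z. norm ((cinner (F w x) y - cinner (F z x) y) / (w - z) - cinner (D x) y)
          \<le> onorm (?Q w) * norm x * norm y"
        using eventually_at_in_open'[OF \<open>open U\<close> \<open>z \<in> U\<close>]
      proof eventually_elim
        case (elim w)
        have bl: "bounded_linear (F w)" "bounded_linear (F z)" "bounded_linear D"
          using lin elim \<open>z \<in> U\<close> D by (auto simp: bounded_clinear_def)
        then have "bounded_linear (?Q w)"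
          by (intro bounded_linear_sub bounded_linear_compose[OF bounded_linear_scaleC_right])
        have "(cinner (F w x) y - cinner (F z x) y) / (w - z) - cinner (D x) y = cinner (?Q w x) y"
          by (simp only: cinner_diff_left cinner_scaleC_left divide_inverse mult.commute)
        then have "norm ((cinner (F w x) y - cinner (F z x) y) / (w - z) - cinner (D x) y)
            \<le> norm (?Q w x) * norm y"
          by (simp add: norm_cinner_le)
        also have "\<dots> \<le> onorm (?Q w) * norm x * norm y"
          by (intro mult_right_mono onorm \<open>bounded_linear (?Q w)\<close>) simp
        finally show ?case .
      qed
      show "((\<lambda>w. onorm (?Q w) * norm x * norm y) \<longlongrightarrow> 0) (at z)"
        by (intro tendsto_mult_left_zero lim)
    qed
    then show ?thesis
      unfolding has_field_derivative_iff by (auto simp: LIM_zero_iff)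
  qed
  then show ?thesis
    by (simp add: holomorphic_on_open \<open>open U\<close>)
qed

text \<open>Finite-rank families of this form are the continuations of compressed resolvents. The
  remainder of the difference quotient is the same sum with scalar remainders as coefficients, so
  its operator norm is bounded by a finite sum tending to 0.\<close>

lemma op_analytic_on_sum:
  assumes "open U" and hol: "\<And>i. i \<in> I \<Longrightarrow> g i holomorphic_on U" and "finite I"
  shows "op_analytic_on (\<lambda>z x. \<Sum>i\<in>I. (g i z * cinner x (d i)) *\<^sub>C e i) U"
  unfolding op_analytic_on_def
proof (intro conjI ballI)
  have lin: "bounded_clinear (\<lambda>x. \<Sum>i\<in>I. (c i * cinner x (d i)) *\<^sub>C e i)" for c
  proof (rule bounded_clinearI)
    show "norm (\<Sum>i\<in>I. (c i * cinner x (d i)) *\<^sub>C e i)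
        \<le> norm x * (\<Sum>i\<in>I. cmod (c i) * norm (d i) * norm (e i))" for x
      unfolding sum_distrib_left
    proof (rule sum_norm_le)
      fix i
      have "cmod (c i) * cmod (cinner x (d i)) * norm (e i)
          \<le> cmod (c i) * (norm x * norm (d i)) * norm (e i)"
        by (intro mult_mono norm_cinner_le) auto
      then show "norm ((c i * cinner x (d i)) *\<^sub>C e i)
          \<le> norm x * (cmod (c i) * norm (d i) * norm (e i))"
        by (simp add: norm_scaleC norm_mult algebra_simps)
    qed
  qed (simp_all add: cinner_add_left cinner_scaleC_left distrib_left scaleC_add_left sum.distrib
      scaleC_scaleC complex_vector.scale_sum_right mult.left_commute)
  show "open U" by fact
  show "bounded_clinear (\<lambda>x. \<Sum>i\<in>I. (g i z * cinner x (d i)) *\<^sub>C e i)" for z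
    by (rule lin)
  fix z assume "z \<in> U"
  define g' where "g' i = deriv (g i) z" for i
  let ?D = "\<lambda>x. \<Sum>i\<in>I. (g' i * cinner x (d i)) *\<^sub>C e i"
  define q where "q i w = (g i w - g i z) / (w - z) - g' i" for i w
  have q: "(q i \<longlongrightarrow> 0) (at z)" if "i \<in> I" for i
    using holomorphic_derivI[OF hol[OF that] \<open>open U\<close> \<open>z \<in> U\<close>]
    unfolding has_field_derivative_iff q_def g'_def by (simp add: LIM_zero_iff)
  have "((\<lambda>w. onorm (\<lambda>x. inverse (w - z) *\<^sub>C ((\<Sum>i\<in>I. (g i w * cinner x (d i)) *\<^sub>C e i) -
      (\<Sum>i\<in>I. (g i z * cinner x (d i)) *\<^sub>C e i)) - ?D x)) \<longlongrightarrow> 0) (at z)"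
  proof (rule Lim_null_comparison[OF always_eventually[OF allI]])
    fix w
    \<comment> \<open>Valid also for w = z: division by 0 yields 0, and both sides reduce to minus
      the derivative term. Hence no restriction to a punctured neighbourhood is needed in the
      comparison.\<close>
    have eq: "inverse (w - z) *\<^sub>C ((\<Sum>i\<in>I. (g i w * cinner x (d i)) *\<^sub>C e i) -
        (\<Sum>i\<in>I. (g i z * cinner x (d i)) *\<^sub>C e i)) - ?D x
        = (\<Sum>i\<in>I. (q i w * cinner x (d i)) *\<^sub>C e i)" for x
      unfolding q_def sum_subtractf[symmetric] complex_vector.scale_sum_right
      by (intro sum.cong refl)
        (simp add: scaleC_scaleC divide_inverse left_diff_distrib right_diff_distrib mult_ac
          complex_vector.scale_left_diff_distrib complex_vector.scale_right_diff_distrib)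
    have "onorm (\<lambda>x. \<Sum>i\<in>I. (q i w * cinner x (d i)) *\<^sub>C e i)
        \<le> (\<Sum>i\<in>I. cmod (q i w) * (norm (d i) * norm (e i)))"
    proof (rule onorm_bound)
      fix x
      show "norm (\<Sum>i\<in>I. (q i w * cinner x (d i)) *\<^sub>C e i)
          \<le> (\<Sum>i\<in>I. cmod (q i w) * (norm (d i) * norm (e i))) * norm x"
        unfolding sum_distrib_right
      proof (rule sum_norm_le)
        fix i
        have "cmod (q i w) * cmod (cinner x (d i)) * norm (e i)
            \<le> cmod (q i w) * (norm x * norm (d i)) * norm (e i)"
          by (intro mult_mono norm_cinner_le) auto
        then show "norm ((q i w * cinner x (d i)) *\<^sub>C e i)
            \<le> cmod (q i w) * (norm (d i) * norm (e i)) * norm x"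
          by (simp add: norm_scaleC norm_mult algebra_simps)
      qed
    qed (auto intro: sum_nonneg)
    then show "norm (onorm (\<lambda>x. inverse (w - z) *\<^sub>C ((\<Sum>i\<in>I. (g i w * cinner x (d i)) *\<^sub>C e i) -
        (\<Sum>i\<in>I. (g i z * cinner x (d i)) *\<^sub>C e i)) - ?D x))
        \<le> (\<Sum>i\<in>I. cmod (q i w) * (norm (d i) * norm (e i)))"
      using lin[of "\<lambda>i. q i w"] unfolding eq bounded_clinear_def by (simp add: onorm_pos_le)
  next
    show "((\<lambda>w. \<Sum>i\<in>I. cmod (q i w) * (norm (d i) * norm (e i))) \<longlongrightarrow> 0) (at z)"
      by (intro tendsto_null_sum tendsto_mult_left_zero tendsto_norm_zero q)
  qed
  then show "\<exists>D. bounded_clinear D \<and> ((\<lambda>w. onorm (\<lambda>x. inverse (w - z) *\<^sub>C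
      ((\<Sum>i\<in>I. (g i w * cinner x (d i)) *\<^sub>C e i) - (\<Sum>i\<in>I. (g i z * cinner x (d i)) *\<^sub>C e i)) - D x))
      \<longlongrightarrow> 0) (at z)"
    using lin by blast
qed

text \<open>Existence of one continuation is enough. Any two agree with \<open>f\<close> on an open
  set accumulating at \<open>z0\<close>, so the identity theorem on a ball inside both domains
  forces them to coincide there.\<close>

lemma point_of_analyticityI:
  assumes "open R" "z0 \<in> closure R" "z0 \<in> U" "analytic_continuation R f U F"
  shows "point_of_analyticity R f z0"
  unfolding point_of_analyticity_def
proof (intro conjI allI impI)
  show "\<exists>U F. z0 \<in> U \<and> analytic_continuation R f U F"
    using assms by blast
  fix U F V G
  assume "z0 \<in> U \<and> analytic_continuation R f U F \<and> z0 \<in> V \<and> analytic_continuation R f V G"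
  then have "z0 \<in> U \<inter> V" and F: "op_analytic_on F U" "\<And>z. z \<in> U \<inter> R \<Longrightarrow> F z = f z"
    and G: "op_analytic_on G V" "\<And>z. z \<in> V \<inter> R \<Longrightarrow> G z = f z"
    by (auto simp: analytic_continuation_def)
  then have "open (U \<inter> V)"
    by (auto simp: op_analytic_on_def)
  then obtain r where "r > 0" and r: "ball z0 r \<subseteq> U \<inter> V"
    using \<open>z0 \<in> U \<inter> V\<close> openE by blast
  obtain w where "w \<in> R" "dist w z0 < r"
    using \<open>z0 \<in> closure R\<close> \<open>r > 0\<close> by (auto simp: closure_approachable)
  then have nonempty: "ball z0 r \<inter> R \<noteq> {}"
    by (metis IntI dist_commute empty_iff mem_ball)
  have "F z x = G z x" if z: "z \<in> ball z0 r" for z x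
  proof -
    \<comment> \<open>The difference at the fixed point \<open>z\<close> serves as test vector. The
      scalar identity theorem is applied with \<open>y\<close> held constant, and at
      \<open>z\<close> it gives \<open>cinner y y = 0\<close>.\<close>
    define y where "y = F z x - G z x"
    have "cinner (F z x) y = cinner (G z x) y"
    proof (rule analytic_continuation_open[where s = "ball z0 r \<inter> R" and s' = "ball z0 r"
          and f = "\<lambda>z. cinner (F z x) y" and g = "\<lambda>z. cinner (G z x) y"])
      show "(\<lambda>z. cinner (F z x) y) holomorphic_on ball z0 r"
        by (rule holomorphic_on_subset[OF holomorphic_cinner_op_analytic[OF F(1)]]) (use r in auto)
      show "(\<lambda>z. cinner (G z x) y) holomorphic_on ball z0 r"
        by (rule holomorphic_on_subset[OF holomorphic_cinner_op_analytic[OF G(1)]]) (use r in auto)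
      show "cinner (F w x) y = cinner (G w x) y" if "w \<in> ball z0 r \<inter> R" for w
      proof -
        have "w \<in> U \<inter> R" "w \<in> V \<inter> R"
          using that r by blast+
        then show ?thesis
          by (simp only: F(2) G(2))
      qed
    qed (use nonempty z \<open>open R\<close> in auto)
    then have "cinner y y = 0"
      by (simp add: y_def cinner_diff_left)
    then show ?thesis
      by (simp add: y_def cinner_self_eq_zero_iff)
  qed
  then show "\<forall>\<^sub>F z in nhds z0. F z = G z"
    using eventually_nhds_in_open[of "ball z0 r" z0] \<open>r > 0\<close>
    by (auto elim!: eventually_mono)
qed


section \<open>Finite-dimensional compressions\<close>

text \<open>Gram-Schmidt by induction: the component of the new vector orthogonal to the earlier
  span is normalised and added, unless it vanishes, in which case the span has not grown.\<close>

lemma finite_orthonormal_basis: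
  fixes B :: "'a::complex_inner set"
  assumes "finite B"
  shows "\<exists>E. finite E \<and> cspan E = cspan B \<and>
    (\<forall>e\<in>E. \<forall>f\<in>E. cinner e f = (if e = f then 1 else 0))"
  using assms
proof (induction B)
  case empty
  then show ?case by (intro exI[of _ "{}"]) auto
next
  case (insert b B)
  then obtain E where "finite E" and span: "cspan E = cspan B"
    and E: "\<And>e f. e \<in> E \<Longrightarrow> f \<in> E \<Longrightarrow> cinner e f = (if e = f then 1 else 0)"
    by blast
  define s where "s = (\<Sum>e\<in>E. cinner b e *\<^sub>C e)"
  define p where "p = b - s"
  have "s \<in> cspan E"
    unfolding s_def
    by (intro complex_vector.span_sum complex_vector.span_scale complex_vector.span_base)
  have orth: "cinner p f = 0" if "f \<in> E" for f
  proof -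
    have "cinner s f = (\<Sum>e\<in>E. if e = f then cinner b e else 0)"
      unfolding s_def cinner_sum_left
      by (intro sum.cong refl) (simp add: cinner_scaleC_left E that)
    also have "\<dots> = cinner b f"
      using \<open>finite E\<close> that by simp
    finally show ?thesis
      by (simp add: p_def cinner_diff_left)
  qed
  show ?case
  proof (cases "p = 0")
    case True
    then have "b \<in> cspan B"
      using \<open>s \<in> cspan E\<close> span by (simp add: p_def)
    then have "cspan (insert b B) = cspan B"
      by (rule complex_vector.span_redundant)
    then show ?thesis
      using \<open>finite E\<close> span E by (intro exI[of _ E]) simp
  next
    case False
    define n where "n = complex_of_real (norm p)"
    have "n \<noteq> 0" using False by (simp add: n_def)
    define e where "e = inverse n *\<^sub>C p"
    have p: "p = n *\<^sub>C e"
      using \<open>n \<noteq> 0\<close> by (simp add: e_def scaleC_scaleC)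
    have "cinner p p = n * n" "cnj n = n"
      by (simp_all add: n_def cinner_self power2_eq_square)
    then have "cinner e e = 1"
      using \<open>n \<noteq> 0\<close> by (simp add: e_def cinner_scaleC_left cinner_scaleC_right field_simps)
    have left: "cinner e f = 0" if "f \<in> E" for f
      using orth[OF that] by (simp add: e_def cinner_scaleC_left)
    have right: "cinner f e = 0" if "f \<in> E" for f
      using left[OF that] by (subst cinner_commute) simp
    have "cspan (insert e E) = cspan (insert b B)"
      unfolding complex_vector.span_eq
    proof (intro conjI insert_subsetI subsetI)
      have sub: "cspan E \<subseteq> cspan (insert b B)"
        unfolding span by (intro complex_vector.span_mono) auto
      then have "s \<in> cspan (insert b B)"
        using \<open>s \<in> cspan E\<close> by blast
      then show "e \<in> cspan (insert b B)"
        by (simp add: e_def p_def complex_vector.span_scale complex_vector.span_diff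
            complex_vector.span_base)
      show "f \<in> cspan (insert b B)" if "f \<in> E" for f
        using sub complex_vector.span_base[OF that] by blast
      have sub': "cspan E \<subseteq> cspan (insert e E)"
        by (intro complex_vector.span_mono) auto
      have "b = n *\<^sub>C e + s"
        by (simp add: p_def flip: p)
      moreover have "n *\<^sub>C e + s \<in> cspan (insert e E)"
        using sub' \<open>s \<in> cspan E\<close>
        by (simp add: subsetD complex_vector.span_scale complex_vector.span_add
            complex_vector.span_base)
      ultimately show "b \<in> cspan (insert e E)"
        by simp
      show "f \<in> cspan (insert e E)" if "f \<in> B" for f
        using sub' complex_vector.span_base[OF that] unfolding span by blast
    qed
    moreover have "e \<notin> E"
      using left \<open>cinner e e = 1\<close> by force
    then have "\<forall>x\<in>insert e E. \<forall>y\<in>insert e E. cinner x y = (if x = y then 1 else 0)"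
      using E left right \<open>cinner e e = 1\<close> by auto
    ultimately show ?thesis
      using \<open>finite E\<close> by (intro exI[of _ "insert e E"]) simp
  qed
qed

text \<open>Positive \<open>cdim\<close> forces finite dimension, because \<open>card\<close> of an
  infinite basis is 0. A finite basis can then be orthonormalised.\<close>

lemma csubspace_orthonormal_basis:
  fixes V :: "'a::complex_inner set"
  assumes "csubspace V" "cdim V > 0"
  obtains E where "finite E" "cspan E = V"
    "\<And>e f. e \<in> E \<Longrightarrow> f \<in> E \<Longrightarrow> cinner e f = (if e = f then 1 else 0)"
proof -
  obtain B where B: "B \<subseteq> V" "V \<subseteq> cspan B" "card B = cdim V"
    by (rule complex_vector.basis_exists[of V])
  then have "finite B"
    using \<open>cdim V > 0\<close> by (intro card_ge_0_finite) simp
  have "cspan B \<subseteq> V"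
    by (rule complex_vector.span_minimal[OF B(1) \<open>csubspace V\<close>])
  then have "cspan B = V"
    using B(2) by (rule subset_antisym)
  obtain E where E: "finite E" "cspan E = cspan B"
    "\<forall>e\<in>E. \<forall>f\<in>E. cinner e f = (if e = f then 1 else 0)"
    using finite_orthonormal_basis[OF \<open>finite B\<close>] by (elim exE conjE)
  show ?thesis
    by (rule that[OF E(1)]) (simp_all only: E(2) \<open>cspan B = V\<close> E(3)[rule_format])
qed

text \<open>\<open>orth_proj\<close> is given by a definite description, so both halves are needed:
  the Fourier sum leaves an orthogonal remainder, and any other candidate differs from it by a
  vector orthogonal to itself.\<close>

lemma orth_proj_cspan:
  assumes "finite E" and E: "\<And>e f. e \<in> E \<Longrightarrow> f \<in> E \<Longrightarrow> cinner e f = (if e = f then 1 else 0)"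
  shows "orth_proj (cspan E) x = (\<Sum>e\<in>E. cinner x e *\<^sub>C e)"
  unfolding orth_proj_def
proof (rule the_equality)
  let ?p = "\<Sum>e\<in>E. cinner x e *\<^sub>C e"
  have p: "?p \<in> cspan E"
    by (intro complex_vector.span_sum complex_vector.span_scale complex_vector.span_base)
  have orth: "cinner (x - ?p) v = 0" if "v \<in> cspan E" for v
    using that
  proof (induction rule: complex_vector.span_induct)
    case base
    show ?case
      by (rule complex_vector.subspaceI)
        (auto simp: cinner_add_right cinner_scaleC_right)
  next
    case (step f)
    have "cinner ?p f = (\<Sum>e\<in>E. if e = f then cinner x e else 0)"
      unfolding cinner_sum_left by (intro sum.cong refl) (simp add: cinner_scaleC_left E step)
    also have "\<dots> = cinner x f"
      using \<open>finite E\<close> step by simp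
    finally show ?case
      by (simp add: cinner_diff_left)
  qed
  show "?p \<in> cspan E \<and> (\<forall>v\<in>cspan E. cinner (x - ?p) v = 0)"
    using p orth by blast
  fix q assume q: "q \<in> cspan E \<and> (\<forall>v\<in>cspan E. cinner (x - q) v = 0)"
  then have "q - ?p \<in> cspan E"
    using p complex_vector.span_diff by blast
  then have "cinner (x - ?p) (q - ?p) - cinner (x - q) (q - ?p) = 0"
    using q orth by simp
  then have "cinner (q - ?p) (q - ?p) = 0"
    by (simp only: cinner_diff_left[symmetric]) simp
  then show "q = ?p"
    by (simp add: cinner_self_eq_zero_iff)
qed

section \<open>Holomorphic continuation of matrix elements of the resolvent\<close>

text \<open>Balls are used because finitely many concentric ones have a smallest member, which is
  connected as \<open>analytic_continuation\<close> demands.\<close>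

definition continuable :: "('h::chilbert_space \<times> 'h) set \<Rightarrow> complex \<Rightarrow> 'h \<Rightarrow> 'h \<Rightarrow> bool"
  where "continuable T z0 d e \<longleftrightarrow> (\<exists>r>0. \<exists>g. g holomorphic_on ball z0 r \<and>
    (\<forall>z\<in>ball z0 r \<inter> resolvent_set T. cinner (resolvent T z d) e = g z))"

lemma continuableI:
  assumes "open U" "z0 \<in> U" "g holomorphic_on U"
    and "\<And>z. z \<in> U \<Longrightarrow> z \<in> resolvent_set T \<Longrightarrow> cinner (resolvent T z d) e = g z"
  shows "continuable T z0 d e"
proof -
  obtain r where "r > 0" "ball z0 r \<subseteq> U"
    using assms(1,2) openE by blast
  then show ?thesis
    unfolding continuable_def using assms(3,4) holomorphic_on_subset by blast
qed

lemma continuableE: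
  assumes "continuable T z0 d e"
  obtains U g where "open U" "z0 \<in> U" "g holomorphic_on U"
    "\<And>z. z \<in> U \<Longrightarrow> z \<in> resolvent_set T \<Longrightarrow> cinner (resolvent T z d) e = g z"
proof -
  obtain r g where "r > 0" "g holomorphic_on ball z0 r"
    "\<forall>z\<in>ball z0 r \<inter> resolvent_set T. cinner (resolvent T z d) e = g z"
    using assms unfolding continuable_def by blast
  then show ?thesis
    by (intro that[of "ball z0 r" g]) auto
qed

lemma continuable_resolvent_set:
  assumes "z0 \<in> resolvent_set T"
  shows "continuable T z0 d e"
  by (rule continuableI[OF open_resolvent_set assms holomorphic_resolvent refl])

text \<open>A single two-term rule serves for sums and multiples in either vector; pure multiples
  are the case b = 0.\<close>

lemma continuable_combine:
  assumes "continuable T z0 d e" "continuable T z0 d' e'"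
    and "\<And>z. z \<in> resolvent_set T \<Longrightarrow> cinner (resolvent T z d'') e''
      = a * cinner (resolvent T z d) e + b * cinner (resolvent T z d') e'"
  shows "continuable T z0 d'' e''"
proof -
  obtain U g where U: "open U" "z0 \<in> U" "g holomorphic_on U"
    "\<And>z. z \<in> U \<Longrightarrow> z \<in> resolvent_set T \<Longrightarrow> cinner (resolvent T z d) e = g z"
    using assms(1) by (rule continuableE) blast
  obtain V h where V: "open V" "z0 \<in> V" "h holomorphic_on V"
    "\<And>z. z \<in> V \<Longrightarrow> z \<in> resolvent_set T \<Longrightarrow> cinner (resolvent T z d') e' = h z"
    using assms(2) by (rule continuableE) blast
  show ?thesis
  proof (rule continuableI[of "U \<inter> V"])
    show "(\<lambda>z. a * g z + b * h z) holomorphic_on U \<inter> V"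
      by (intro holomorphic_intros holomorphic_on_subset[OF U(3)] holomorphic_on_subset[OF V(3)]) auto
  qed (use U V assms(3) in auto)
qed

text \<open>With one vector fixed, the other vectors giving a continuable element form a subspace.
  Span induction runs first over \<open>d\<close> with \<open>e\<close> a generator, then over
  \<open>e\<close>; the coefficient is conjugated in the second, antilinear slot.\<close>

lemma continuable_cspan:
  assumes "\<And>x y. x \<in> X \<Longrightarrow> y \<in> Y \<Longrightarrow> continuable T z0 x y" "d \<in> cspan X" "e \<in> cspan Y"
  shows "continuable T z0 d e"
proof -
  have zero: "continuable T z0 d e" if "d = 0 \<or> e = 0" for d e
    using that
    by (intro continuableI[of UNIV _ "\<lambda>_. 0"])
      (auto simp: bounded_clinear_zero[OF bounded_clinear_resolvent])
  have left: "continuable T z0 d y" if "y \<in> Y" for y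
    using \<open>d \<in> cspan X\<close>
  proof (induction rule: complex_vector.span_induct)
    case base
    show ?case
    proof (rule complex_vector.subspaceI; unfold mem_Collect_eq)
      show "continuable T z0 (u + v) y" if "continuable T z0 u y" "continuable T z0 v y" for u v
        by (rule continuable_combine[OF that, where a = 1 and b = 1])
          (simp add: bounded_clinear_add[OF bounded_clinear_resolvent] cinner_add_left)
      show "continuable T z0 (c *\<^sub>C u) y" if "continuable T z0 u y" for c u
        by (rule continuable_combine[OF that that, where a = c and b = 0])
          (simp add: bounded_clinear_scaleC[OF bounded_clinear_resolvent] cinner_scaleC_left)
    qed (simp add: zero)
  qed (use assms(1) that in blast)
  show ?thesis
    using \<open>e \<in> cspan Y\<close>
  proof (induction rule: complex_vector.span_induct)
    case base
    show ?case
    proof (rule complex_vector.subspaceI; unfold mem_Collect_eq)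
      show "continuable T z0 d (u + v)" if "continuable T z0 d u" "continuable T z0 d v" for u v
        by (rule continuable_combine[OF that, where a = 1 and b = 1]) (simp add: cinner_add_right)
      show "continuable T z0 d (c *\<^sub>C u)" if "continuable T z0 d u" for c u
        by (rule continuable_combine[OF that that, where a = "cnj c" and b = 0])
          (simp add: cinner_scaleC_right)
    qed (simp add: zero)
  qed (rule left)
qed

text \<open>In orthonormal bases of \<open>V\<close> and \<open>W\<close> the compression is a
  finite matrix of elements of the resolvent. Each entry is continued separately, and the
  continuations are assembled on a common ball.\<close>

lemma point_of_analyticity_compression:
  fixes T :: "('h::chilbert_space \<times> 'h) set"
  assumes "z0 \<in> closure (resolvent_set T)"
    and V: "csubspace V" "cdim V > 0" and W: "csubspace W" "cdim W > 0"
    and cont: "\<And>d e. d \<in> V \<Longrightarrow> e \<in> W \<Longrightarrow> continuable T z0 d e"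
  shows "point_of_analyticity (resolvent_set T)
    (\<lambda>z. orth_proj W \<circ> resolvent T z \<circ> orth_proj V) z0"
proof -
  obtain D where "finite D" and D: "cspan D = V"
    "\<And>e f. e \<in> D \<Longrightarrow> f \<in> D \<Longrightarrow> cinner e f = (if e = f then 1 else 0)"
    by (rule csubspace_orthonormal_basis[OF V]) blast
  obtain E where "finite E" and E: "cspan E = W"
    "\<And>e f. e \<in> E \<Longrightarrow> f \<in> E \<Longrightarrow> cinner e f = (if e = f then 1 else 0)"
    by (rule csubspace_orthonormal_basis[OF W]) blast
  have proj_V: "orth_proj V x = (\<Sum>d\<in>D. cinner x d *\<^sub>C d)" for x
    unfolding D(1)[symmetric] by (rule orth_proj_cspan[OF \<open>finite D\<close> D(2)])
  have proj_W: "orth_proj W x = (\<Sum>e\<in>E. cinner x e *\<^sub>C e)" for x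
    unfolding E(1)[symmetric] by (rule orth_proj_cspan[OF \<open>finite E\<close> E(2)])
  let ?I = "D \<times> E"
  have fin: "finite ?I"
    using \<open>finite D\<close> \<open>finite E\<close> by simp
  have "\<forall>i\<in>?I. \<exists>r g. r > 0 \<and> g holomorphic_on ball z0 r \<and>
      (\<forall>z\<in>ball z0 r \<inter> resolvent_set T. cinner (resolvent T z (fst i)) (snd i) = g z)"
  proof
    fix i assume "i \<in> ?I"
    then have "continuable T z0 (fst i) (snd i)"
      using cont D(1) E(1) complex_vector.span_base by (metis mem_Times_iff)
    then show "\<exists>r g. r > 0 \<and> g holomorphic_on ball z0 r \<and>
        (\<forall>z\<in>ball z0 r \<inter> resolvent_set T. cinner (resolvent T z (fst i)) (snd i) = g z)"
      unfolding continuable_def by blast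
  qed
  from bchoice[OF this] obtain r where "\<forall>i\<in>?I. \<exists>g. r i > 0 \<and> g holomorphic_on ball z0 (r i) \<and>
      (\<forall>z\<in>ball z0 (r i) \<inter> resolvent_set T. cinner (resolvent T z (fst i)) (snd i) = g z)"
    by blast
  from bchoice[OF this] obtain g where r: "\<And>i. i \<in> ?I \<Longrightarrow> r i > 0"
    and g: "\<And>i. i \<in> ?I \<Longrightarrow> g i holomorphic_on ball z0 (r i)"
      "\<And>i z. i \<in> ?I \<Longrightarrow> z \<in> ball z0 (r i) \<Longrightarrow> z \<in> resolvent_set T \<Longrightarrow>
        cinner (resolvent T z (fst i)) (snd i) = g i z"
    by blast
  \<comment> \<open>The element 1 keeps the set nonempty, so \<open>Min\<close> is meaningful
    whatever the index set.\<close>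
  define \<rho> where "\<rho> = Min (insert 1 (r ` ?I))"
  have "\<rho> > 0"
    unfolding \<rho>_def using fin r by (subst Min_gr_iff) auto
  have \<rho>: "ball z0 \<rho> \<subseteq> ball z0 (r i)" if "i \<in> ?I" for i
    unfolding \<rho>_def using fin that by (intro subset_ball Min_le) auto
  let ?F = "\<lambda>z x. \<Sum>i\<in>?I. (g i z * cinner x (fst i)) *\<^sub>C snd i"
  show ?thesis
  proof (rule point_of_analyticityI[OF open_resolvent_set assms(1)])
    show "z0 \<in> ball z0 \<rho>"
      using \<open>\<rho> > 0\<close> by simp
    show "analytic_continuation (resolvent_set T)
        (\<lambda>z. orth_proj W \<circ> resolvent T z \<circ> orth_proj V) (ball z0 \<rho>) ?F"
      unfolding analytic_continuation_def
    proof (intro conjI ballI)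
      obtain w where "w \<in> resolvent_set T" "dist w z0 < \<rho>"
        using assms(1) \<open>\<rho> > 0\<close> by (auto simp: closure_approachable)
      then show "ball z0 \<rho> \<inter> resolvent_set T \<noteq> {}"
        by (metis IntI dist_commute empty_iff mem_ball)
      show "op_analytic_on ?F (ball z0 \<rho>)"
        by (intro op_analytic_on_sum fin) (use g(1) \<rho> holomorphic_on_subset in blast)+
      fix z assume z: "z \<in> ball z0 \<rho> \<inter> resolvent_set T"
      then have R: "bounded_clinear (resolvent T z)"
        by (simp add: bounded_clinear_resolvent)
      show "?F z = orth_proj W \<circ> resolvent T z \<circ> orth_proj V"
      proof
        fix x
        have "resolvent T z (orth_proj V x) = (\<Sum>d\<in>D. cinner x d *\<^sub>C resolvent T z d)"
          using R unfolding proj_V bounded_clinear_def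
          by (simp add: bounded_linear.linear linear_sum)
        then have "(orth_proj W \<circ> resolvent T z \<circ> orth_proj V) x
            = (\<Sum>e\<in>E. \<Sum>d\<in>D. (cinner (resolvent T z d) e * cinner x d) *\<^sub>C e)"
          unfolding comp_apply proj_W
          by (simp add: cinner_sum_left cinner_scaleC_left complex_vector.scale_sum_left mult.commute)
        also have "\<dots> = (\<Sum>d\<in>D. \<Sum>e\<in>E. (cinner (resolvent T z d) e * cinner x d) *\<^sub>C e)"
          by (rule sum.swap)
        also have "\<dots> = (\<Sum>i\<in>?I. (cinner (resolvent T z (fst i)) (snd i) * cinner x (fst i)) *\<^sub>C snd i)"
          by (simp add: sum.cartesian_product case_prod_beta)
        also have "\<dots> = ?F z x"
        proof (rule sum.cong[OF refl])
          fix i assume "i \<in> ?I"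
          then show "(cinner (resolvent T z (fst i)) (snd i) * cinner x (fst i)) *\<^sub>C snd i
              = (g i z * cinner x (fst i)) *\<^sub>C snd i"
            using g(2)[of i z] \<rho>[of i] z by auto
        qed
        finally show "?F z x = (orth_proj W \<circ> resolvent T z \<circ> orth_proj V) x"
          by simp
      qed
    qed simp
  qed
qed


section \<open>Adjoints of operators\<close>

text \<open>The bounded adjoint of the resolvent of \<open>S\<close> is the resolvent of the adjoint
  of \<open>S\<close> at the conjugate point. Testing against all pairs in \<open>S\<close> shows
  that it solves the equation; testing a solution against the pairs produced by \<open>?C\<close>
  shows uniqueness.\<close>

lemma op_adjoint_resolvent:
  fixes S :: "('h::chilbert_space \<times> 'h) set"
  assumes \<nu>: "\<nu> \<in> resolvent_set S"
  shows "cnj \<nu> \<in> resolvent_set (op_adjoint S)"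
    and "cinner (resolvent S \<nu> x) y = cinner x (resolvent (op_adjoint S) (cnj \<nu>) y)"
proof -
  let ?C = "resolvent S \<nu>"
  note C = bounded_clinear_resolvent[OF \<nu>]
  have adj: "(u, w) \<in> op_adjoint S \<Longrightarrow> (v, z) \<in> S \<Longrightarrow> cinner z u = cinner v w" for u w v z
    by (auto simp: op_adjoint_def)
  have mem: "(cadjoint ?C f, f + cnj \<nu> *\<^sub>C cadjoint ?C f) \<in> op_adjoint S" for f
  proof -
    have "cinner z (cadjoint ?C f) = cinner v (f + cnj \<nu> *\<^sub>C cadjoint ?C f)" if "(v, z) \<in> S" for v z
    proof -
      have "?C (z - \<nu> *\<^sub>C v) = v"
        by (rule resolvent_unique[OF \<nu> that refl])
      then have "cinner (z - \<nu> *\<^sub>C v) (cadjoint ?C f) = cinner v f"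
        by (simp add: cadjoint_cinner[OF C, symmetric])
      then show ?thesis
        by (simp add: cinner_diff_left cinner_scaleC_left cinner_add_right cinner_scaleC_right
            algebra_simps)
    qed
    then show ?thesis
      by (auto simp: op_adjoint_def)
  qed
  have uniq: "u = cadjoint ?C f" if "(u, w) \<in> op_adjoint S" "w - cnj \<nu> *\<^sub>C u = f" for u w f
  proof (rule cinner_eq_imp_eq)
    fix y
    have "cinner (y + \<nu> *\<^sub>C ?C y) u = cinner (?C y) w"
      by (rule adj[OF that(1) resolvent_mem[OF \<nu>]])
    then have "cinner y u = cinner (?C y) (w - cnj \<nu> *\<^sub>C u)"
      by (simp add: cinner_add_left cinner_scaleC_left cinner_diff_right cinner_scaleC_right
          algebra_simps)
    then show "cinner y u = cinner y (cadjoint ?C f)"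
      by (simp add: that(2) cadjoint_cinner[OF C])
  qed
  have ex: "\<exists>w. (cadjoint ?C f, w) \<in> op_adjoint S \<and> w - cnj \<nu> *\<^sub>C cadjoint ?C f = f" for f
    by (rule exI, rule conjI, rule mem) simp
  have "resolvent (op_adjoint S) (cnj \<nu>) f = cadjoint ?C f" for f
    unfolding resolvent_def[of "op_adjoint S"]
    by (rule the_equality, rule ex) (elim exE conjE, rule uniq)
  then have res: "resolvent (op_adjoint S) (cnj \<nu>) = cadjoint ?C" ..
  show "cnj \<nu> \<in> resolvent_set (op_adjoint S)"
    unfolding resolvent_set_def mem_Collect_eq res
  proof (intro conjI allI bounded_clinear_cadjoint[OF C])
    show "\<exists>!u. \<exists>w. (u, w) \<in> op_adjoint S \<and> w - cnj \<nu> *\<^sub>C u = f" for f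
      by (rule ex1I, rule ex) (elim exE conjE, rule uniq)
  qed
  show "cinner (resolvent S \<nu> x) y = cinner x (resolvent (op_adjoint S) (cnj \<nu>) y)"
    unfolding res by (rule cadjoint_cinner[OF C])
qed

lemma op_adjoint_add_scaleC:
  assumes "(u, w) \<in> op_adjoint S" "(u', w') \<in> op_adjoint S"
  shows "(u + c *\<^sub>C u', w + c *\<^sub>C w') \<in> op_adjoint S"
  unfolding op_adjoint_def
proof clarsimp
  fix a b assume "(a, b) \<in> S"
  then have "cinner b u = cinner a w" "cinner b u' = cinner a w'"
    using assms by (auto simp: op_adjoint_def)
  then show "cinner b (u + c *\<^sub>C u') = cinner a (w + c *\<^sub>C w')"
    by (simp add: cinner_add_right cinner_scaleC_right)
qed

section \<open>Continuability when resolvents are applied to the vectors\<close>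

text \<open>The resolvent identity expresses the new matrix element as a difference of the old one
  and a constant, divided by z - \<delta>; this is holomorphic near \<open>z0\<close> because
  \<open>z0\<close> differs from \<delta>.\<close>

lemma continuable_resolvent_left:
  assumes "continuable T z0 d e" "z0 \<noteq> \<delta>" and \<delta>: "\<delta> \<in> resolvent_set T"
  shows "continuable T z0 (resolvent T \<delta> d) e"
proof -
  obtain U g where U: "open U" "z0 \<in> U" "g holomorphic_on U"
    "\<And>z. z \<in> U \<Longrightarrow> z \<in> resolvent_set T \<Longrightarrow> cinner (resolvent T z d) e = g z"
    using assms(1) by (rule continuableE) blast
  show ?thesis
  proof (rule continuableI[of "U - {\<delta>}"])
    show "(\<lambda>z. (g z - cinner (resolvent T \<delta> d) e) / (z - \<delta>)) holomorphic_on U - {\<delta>}"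
      by (intro holomorphic_intros holomorphic_on_subset[OF U(3)]) auto
    fix z assume z: "z \<in> U - {\<delta>}" "z \<in> resolvent_set T"
    have "g z - cinner (resolvent T \<delta> d) e = (z - \<delta>) * cinner (resolvent T z (resolvent T \<delta> d)) e"
      using U(4)[of z] z cinner_diff_left[of "resolvent T z d" "resolvent T \<delta> d" e]
      by (simp add: resolvent_identity[OF z(2) \<delta>] cinner_scaleC_left)
    then show "cinner (resolvent T z (resolvent T \<delta> d)) e
        = (g z - cinner (resolvent T \<delta> d) e) / (z - \<delta>)"
      using z by simp
  qed (use U assms(2) in \<open>auto simp: open_delete\<close>)
qed

text \<open>Resolvents of \<open>S\<^sup>*\<close> commute, so the resolvent of \<open>S\<close> can be moved to the vector \<open>d\<close>.\<close>

lemma continuable_resolvent_right: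
  assumes "continuable (op_adjoint S) z0 d e" "z0 \<notin> resolvent_set (op_adjoint S)"
    and \<nu>: "\<nu> \<in> resolvent_set S"
  shows "continuable (op_adjoint S) z0 d (resolvent S \<nu> e)"
proof -
  let ?R = "resolvent (op_adjoint S)"
  note \<nu>' = op_adjoint_resolvent(1)[OF \<nu>]
  have "continuable (op_adjoint S) z0 (?R (cnj \<nu>) d) e"
    using assms \<nu>' by (intro continuable_resolvent_left) auto
  then obtain U g where U: "open U" "z0 \<in> U" "g holomorphic_on U"
    "\<And>z. z \<in> U \<Longrightarrow> z \<in> resolvent_set (op_adjoint S) \<Longrightarrow> cinner (?R z (?R (cnj \<nu>) d)) e = g z"
    by (rule continuableE) blast
  show ?thesis
  proof (rule continuableI[of "U - {cnj \<nu>}"])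
    show "g holomorphic_on U - {cnj \<nu>}"
      by (rule holomorphic_on_subset[OF U(3)]) auto
    fix z assume z: "z \<in> U - {cnj \<nu>}" "z \<in> resolvent_set (op_adjoint S)"
    \<comment> \<open>Both orders of the product arise from the resolvent identity with the two
      points exchanged. The common factor is nonzero on the punctured set and cancels.\<close>
    have "(z - cnj \<nu>) *\<^sub>C ?R z (?R (cnj \<nu>) d) = ?R z d - ?R (cnj \<nu>) d"
      by (rule resolvent_identity[OF z(2) \<nu>', symmetric])
    also have "\<dots> = - (?R (cnj \<nu>) d - ?R z d)"
      by simp
    also have "\<dots> = (z - cnj \<nu>) *\<^sub>C ?R (cnj \<nu>) (?R z d)"
      unfolding resolvent_identity[OF \<nu>' z(2)]
      by (simp flip: complex_vector.scale_minus_left)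
    finally have "?R z (?R (cnj \<nu>) d) = ?R (cnj \<nu>) (?R z d)"
      using z(1) by simp
    moreover have "cinner (?R z d) (resolvent S \<nu> e) = cinner (?R (cnj \<nu>) (?R z d)) e"
      by (rule cinner_swap_eq[OF op_adjoint_resolvent(2)[OF \<nu>]])
    ultimately show "cinner (?R z d) (resolvent S \<nu> e) = g z"
      using U(4)[of z] z by simp
  qed (use U assms(2) \<nu>' in \<open>auto simp: open_delete\<close>)
qed


section \<open>Boundary triplets\<close>

text \<open>If both boundary conditions hold, the boundary terms in Green's identity cancel, which
  gives one inclusion. Conversely, \<open>At\<close> is contained in the restriction, so
  \<open>u\<close> lies in the maximal domain, and the boundary condition is recovered from a
  suitable test vector.\<close>

lemma (in boundary_triplet) op_adjoint_restriction:
  assumes B: "bounded_clinear B"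
  shows "op_adjoint (restriction (op_adjoint A) \<Gamma>t\<^sub>1 \<Gamma>t\<^sub>2 (cadjoint B))
    = restriction (op_adjoint At) \<Gamma>\<^sub>1 \<Gamma>\<^sub>2 B" (is "op_adjoint ?S = ?T")
proof (intro subset_antisym subrelI)
  fix u w assume "(u, w) \<in> ?T"
  then have u: "(u, w) \<in> op_adjoint At" "\<Gamma>\<^sub>1 u = B (\<Gamma>\<^sub>2 u)"
    by (auto simp: restriction_def)
  have "cinner z u = cinner v w" if "(v, z) \<in> ?S" for v z
  proof -
    have v: "(v, z) \<in> op_adjoint A" "\<Gamma>t\<^sub>1 v = cadjoint B (\<Gamma>t\<^sub>2 v)"
      using that by (auto simp: restriction_def)
    have "cinner w v = cinner u z"
      using green[OF u(1) v(1)] by (simp add: u(2) v(2) cadjoint_cinner[OF B])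
    then show ?thesis
      by (rule cinner_swap_eq[symmetric])
  qed
  then show "(u, w) \<in> op_adjoint ?S"
    by (auto simp: op_adjoint_def)
next
  fix u w assume uw: "(u, w) \<in> op_adjoint ?S"
  have S: "cinner z u = cinner v w" if "(v, z) \<in> ?S" for v z
    using uw that by (auto simp: op_adjoint_def)
  have "At \<subseteq> ?S"
  proof (rule subrelI)
    fix v z assume vz: "(v, z) \<in> At"
    then have "v \<in> Domain At" by blast
    then have "\<Gamma>t\<^sub>1 v = 0" "\<Gamma>t\<^sub>2 v = 0"
      unfolding domain_At by simp_all
    then show "(v, z) \<in> ?S"
      using vz At_subset bounded_clinear_zero[OF bounded_clinear_cadjoint[OF B]]
      by (auto simp: restriction_def)
  qed
  then have mem: "(u, w) \<in> op_adjoint At"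
    using uw unfolding op_adjoint_def by blast
  define y where "y = \<Gamma>\<^sub>1 u - B (\<Gamma>\<^sub>2 u)"
  \<comment> \<open>Surjectivity provides a test vector in the domain of the restricted operator
    whose second boundary value is the defect \<open>y\<close>; Green's identity then reduces to the
    vanishing of \<open>cinner y y\<close>.\<close>
  have "(cadjoint B y, y) \<in> (\<lambda>v. (\<Gamma>t\<^sub>1 v, \<Gamma>t\<^sub>2 v)) ` Domain (op_adjoint A)"
    by (simp add: surj(2))
  then obtain v z where v: "(v, z) \<in> op_adjoint A" "\<Gamma>t\<^sub>1 v = cadjoint B y" "\<Gamma>t\<^sub>2 v = y"
    by auto
  then have "cinner z u = cinner v w"
    by (intro S) (simp add: restriction_def)
  then have "cinner w v = cinner u z"
    by (rule cinner_swap_eq[symmetric])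
  then have "cinner (\<Gamma>\<^sub>1 u) y - cinner (B (\<Gamma>\<^sub>2 u)) y = 0"
    using green[OF mem v(1)] by (simp add: v cadjoint_cinner[OF B])
  then have "cinner y y = 0"
    by (simp add: y_def cinner_diff_left)
  then show "(u, w) \<in> ?T"
    using mem by (simp add: restriction_def y_def cinner_self_eq_zero_iff)
qed

text \<open>For \<open>d\<close> in the kernel of \<open>At\<^sup>* - \<mu>\<close>, the vector \<open>u = d + (z - \<mu>) (A\<^sub>B - z)\<^sup>-\<^sup>1 d\<close> lies in
  the kernel of \<open>At\<^sup>* - z\<close> and has the same boundary value as \<open>d\<close>.\<close>

lemma (in boundary_triplet) resolvent_M_function:
  fixes B :: "'k \<Rightarrow> 'p"
  defines "T \<equiv> restriction (op_adjoint At) \<Gamma>\<^sub>1 \<Gamma>\<^sub>2 B"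
  assumes B: "bounded_clinear B"
    and d: "d \<in> eigenspace (op_adjoint At) \<mu>" and e: "e \<in> eigenspace (op_adjoint A) \<nu>"
    and z: "z \<in> resolvent_set T"
  shows "(z - cnj \<nu>) * (cinner d e + (z - \<mu>) * cinner (resolvent T z d) e)
    = cinner (\<Gamma>\<^sub>1 d - B (\<Gamma>\<^sub>2 d)) (\<Gamma>t\<^sub>2 e)
      - cinner (M_function (op_adjoint At) \<Gamma>\<^sub>1 \<Gamma>\<^sub>2 B z (\<Gamma>\<^sub>1 d - B (\<Gamma>\<^sub>2 d)))
          (\<Gamma>t\<^sub>1 e - cadjoint B (\<Gamma>t\<^sub>2 e))"
proof -
  let ?L = "op_adjoint At"
  define f where "f = \<Gamma>\<^sub>1 d - B (\<Gamma>\<^sub>2 d)"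
  define x where "x = resolvent T z d"
  define u where "u = d + (z - \<mu>) *\<^sub>C x"
  have lin: "\<Gamma> (a + c *\<^sub>C b) = \<Gamma> a + c *\<^sub>C \<Gamma> b"
    if "clinear_on (Domain ?L) \<Gamma>" "(a, a') \<in> ?L" "(b, b') \<in> ?L"
    for \<Gamma> :: "'h \<Rightarrow> 'x::complex_inner" and a a' b b' c
  proof -
    \<comment> \<open>Closure under multiples is the case b + (c - 1) b of the combined
      rule.\<close>
    have "c *\<^sub>C b \<in> Domain ?L"
      using op_adjoint_add_scaleC[OF that(3,3), of "c - 1"]
      by (auto simp: complex_vector.scale_left_diff_distrib)
    then show ?thesis
      using that unfolding clinear_on_def by (metis DomainI)
  qed
  have bdry: "\<Gamma>\<^sub>1 (a + c *\<^sub>C b) - B (\<Gamma>\<^sub>2 (a + c *\<^sub>C b))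
      = (\<Gamma>\<^sub>1 a - B (\<Gamma>\<^sub>2 a)) + c *\<^sub>C (\<Gamma>\<^sub>1 b - B (\<Gamma>\<^sub>2 b))"
    if "(a, a') \<in> ?L" "(b, b') \<in> ?L" for a a' b b' c
    by (simp add: lin[OF linear(1) that] lin[OF linear(2) that] bounded_clinear_add[OF B]
        bounded_clinear_scaleC[OF B] complex_vector.scale_right_diff_distrib)
  have x: "(x, d + z *\<^sub>C x) \<in> ?L" "\<Gamma>\<^sub>1 x - B (\<Gamma>\<^sub>2 x) = 0"
    using resolvent_mem[OF z, of d] by (auto simp: T_def restriction_def x_def)
  have d': "(d, \<mu> *\<^sub>C d) \<in> ?L"
    using d by (simp add: eigenspace_def)
  have "\<mu> *\<^sub>C d + (z - \<mu>) *\<^sub>C (d + z *\<^sub>C x) = z *\<^sub>C u"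
    by (simp add: u_def scaleC_add_right scaleC_scaleC complex_vector.scale_left_diff_distrib
        algebra_simps)
  then have u: "(u, z *\<^sub>C u) \<in> ?L"
    using op_adjoint_add_scaleC[OF d' x(1), of "z - \<mu>"] by (simp add: u_def)
  have uf: "\<Gamma>\<^sub>1 u - B (\<Gamma>\<^sub>2 u) = f"
    unfolding u_def bdry[OF d' x(1)] by (simp add: x(2) f_def)
  have M: "M_function ?L \<Gamma>\<^sub>1 \<Gamma>\<^sub>2 B z f = \<Gamma>\<^sub>2 u"
    unfolding M_function_def
  proof (rule the_equality)
    show "\<exists>u'\<in>eigenspace ?L z. \<Gamma>\<^sub>1 u' - B (\<Gamma>\<^sub>2 u') = f \<and> \<Gamma>\<^sub>2 u' = \<Gamma>\<^sub>2 u"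
      using u uf by (auto simp: eigenspace_def)
    fix k assume "\<exists>u'\<in>eigenspace ?L z. \<Gamma>\<^sub>1 u' - B (\<Gamma>\<^sub>2 u') = f \<and> \<Gamma>\<^sub>2 u' = k"
    then obtain u' where u': "(u', z *\<^sub>C u') \<in> ?L" "\<Gamma>\<^sub>1 u' - B (\<Gamma>\<^sub>2 u') = f" "\<Gamma>\<^sub>2 u' = k"
      by (auto simp: eigenspace_def)
    \<comment> \<open>Two kernel vectors with equal boundary value differ by an element of the
      kernel of T - z, which is trivial for z in the resolvent set; so the description in
      \<open>M_function\<close> has a unique solution.\<close>
    define v where "v = u' + (- 1) *\<^sub>C u"
    have "z *\<^sub>C u' + (- 1) *\<^sub>C z *\<^sub>C u = z *\<^sub>C v"
      by (simp add: v_def complex_vector.scale_right_diff_distrib)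
    then have "(v, z *\<^sub>C v) \<in> ?L"
      using op_adjoint_add_scaleC[OF u'(1) u, of "- 1"] by (simp add: v_def)
    moreover have "\<Gamma>\<^sub>1 v - B (\<Gamma>\<^sub>2 v) = 0"
      unfolding v_def bdry[OF u'(1) u] by (simp add: u'(2) uf)
    ultimately have "(v, z *\<^sub>C v) \<in> T"
      by (simp add: T_def restriction_def)
    then have "resolvent T z 0 = v"
      by (rule resolvent_unique[OF z]) simp
    then have "v = 0"
      by (simp add: bounded_clinear_zero[OF bounded_clinear_resolvent[OF z]])
    then show "k = \<Gamma>\<^sub>2 u"
      using u'(3) by (simp add: v_def)
  qed
  have "\<Gamma>\<^sub>1 u = f + B (\<Gamma>\<^sub>2 u)"
    using uf by (simp add: diff_eq_eq)
  moreover have "(e, \<nu> *\<^sub>C e) \<in> op_adjoint A"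
    using e by (simp add: eigenspace_def)
  \<comment> \<open>Green's identity for the eigenvectors \<open>u\<close> and \<open>e\<close>: the
    eigenvalues combine to the factor on the left, and the boundary value of \<open>u\<close>
    replaces \<Gamma>1 of \<open>u\<close>.\<close>
  ultimately have "(z - cnj \<nu>) * cinner u e
      = cinner f (\<Gamma>t\<^sub>2 e) + cinner (B (\<Gamma>\<^sub>2 u)) (\<Gamma>t\<^sub>2 e) - cinner (\<Gamma>\<^sub>2 u) (\<Gamma>t\<^sub>1 e)"
    using green[OF u, of e "\<nu> *\<^sub>C e"]
    by (simp add: cinner_scaleC_left cinner_scaleC_right cinner_add_left left_diff_distrib)
  also have "\<dots> = cinner f (\<Gamma>t\<^sub>2 e) - cinner (\<Gamma>\<^sub>2 u) (\<Gamma>t\<^sub>1 e - cadjoint B (\<Gamma>t\<^sub>2 e))"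
    by (simp add: cadjoint_cinner[OF B] cinner_diff_right)
  finally show ?thesis
    unfolding f_def[symmetric] M x_def[symmetric]
    by (simp add: u_def cinner_add_left cinner_scaleC_left)
qed

text \<open>Solving the preceding identity for the resolvent's matrix element gives a formula in the
  M-function. With the continuation \<open>F\<close> in its place, the formula is holomorphic on
  \<open>U\<close> away from the two excluded poles.\<close>

lemma (in boundary_triplet) continuable_eigenspaces:
  fixes B :: "'k \<Rightarrow> 'p"
  defines "T \<equiv> restriction (op_adjoint At) \<Gamma>\<^sub>1 \<Gamma>\<^sub>2 B"
  assumes B: "bounded_clinear B"
    and d: "d \<in> eigenspace (op_adjoint At) \<mu>" and e: "e \<in> eigenspace (op_adjoint A) \<nu>"
    and "z0 \<noteq> \<mu>" "z0 \<noteq> cnj \<nu>" "z0 \<in> U"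
    and "analytic_continuation (resolvent_set T) (M_function (op_adjoint At) \<Gamma>\<^sub>1 \<Gamma>\<^sub>2 B) U F"
  shows "continuable T z0 d e"
proof -
  have F: "op_analytic_on F U"
    and FM: "\<And>z. z \<in> U \<Longrightarrow> z \<in> resolvent_set T \<Longrightarrow> F z = M_function (op_adjoint At) \<Gamma>\<^sub>1 \<Gamma>\<^sub>2 B z"
    using assms(8) by (auto simp: analytic_continuation_def)
  have "open U"
    using F by (simp add: op_analytic_on_def)
  define f where "f = \<Gamma>\<^sub>1 d - B (\<Gamma>\<^sub>2 d)"
  define k where "k = \<Gamma>t\<^sub>1 e - cadjoint B (\<Gamma>t\<^sub>2 e)"
  let ?g = "\<lambda>z. ((cinner f (\<Gamma>t\<^sub>2 e) - cinner (F z f) k) / (z - cnj \<nu>) - cinner d e) / (z - \<mu>)"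
  show ?thesis
  proof (rule continuableI[of "U - {\<mu>, cnj \<nu>}"])
    show "?g holomorphic_on U - {\<mu>, cnj \<nu>}"
      by (intro holomorphic_intros holomorphic_on_subset[OF holomorphic_cinner_op_analytic[OF F]]) auto
    fix z assume z: "z \<in> U - {\<mu>, cnj \<nu>}" "z \<in> resolvent_set T"
    have "(z - cnj \<nu>) * (cinner d e + (z - \<mu>) * cinner (resolvent T z d) e)
        = cinner f (\<Gamma>t\<^sub>2 e) - cinner (F z f) k"
      using resolvent_M_function[OF B d e z(2)[unfolded T_def]] FM[of z] z
      by (simp add: T_def f_def k_def)
    then have "cinner d e + (z - \<mu>) * cinner (resolvent T z d) e
        = (cinner f (\<Gamma>t\<^sub>2 e) - cinner (F z f) k) / (z - cnj \<nu>)"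
      using z(1) by (simp add: eq_divide_eq mult.commute)
    then show "cinner (resolvent T z d) e = ?g z"
      using z(1) by (simp add: eq_divide_eq mult.commute flip: \<open>cinner d e + _ = _\<close>)
  qed (use \<open>open U\<close> assms in \<open>auto simp: open_Diff\<close>)
qed

section \<open>Solution operators and analyticity of the compressed resolvents\<close>

lemma ran_solution_op_subset: "ran_solution_op T G1 G2 B \<mu> \<subseteq> eigenspace T \<mu>"
  unfolding ran_solution_op_def solution_op_def by (auto intro: inv_into_into)

theorem theorem3p5:
  fixes A At :: "('h::chilbert_space \<times> 'h) set"
    and \<Gamma>\<^sub>1 :: "'h \<Rightarrow> 'p::chilbert_space" and \<Gamma>\<^sub>2 :: "'h \<Rightarrow> 'k::chilbert_space"
    and \<Gamma>t\<^sub>1 :: "'h \<Rightarrow> 'k" and \<Gamma>t\<^sub>2 :: "'h \<Rightarrow> 'p"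
    and B :: "'k \<Rightarrow> 'p"
    and \<mu>\<^sub>0 \<mu>t z\<^sub>0 :: complex
  defines "A_B \<equiv> restriction (op_adjoint At) \<Gamma>\<^sub>1 \<Gamma>\<^sub>2 B"
    and "At_B \<equiv> restriction (op_adjoint A) \<Gamma>t\<^sub>1 \<Gamma>t\<^sub>2 (cadjoint B)"
    and "M_B \<equiv> M_function (op_adjoint At) \<Gamma>\<^sub>1 \<Gamma>\<^sub>2 B"
    and "S \<equiv> S_space (op_adjoint At) \<Gamma>\<^sub>1 \<Gamma>\<^sub>2 B \<mu>\<^sub>0"
    and "T \<equiv> T_space (op_adjoint At) \<Gamma>\<^sub>1 \<Gamma>\<^sub>2 B"
    and "St \<equiv> S_space (op_adjoint A) \<Gamma>t\<^sub>1 \<Gamma>t\<^sub>2 (cadjoint B) \<mu>t"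
    and "Tt \<equiv> T_space (op_adjoint A) \<Gamma>t\<^sub>1 \<Gamma>t\<^sub>2 (cadjoint B)"
  assumes triplet: "boundary_triplet A At \<Gamma>\<^sub>1 \<Gamma>\<^sub>2 \<Gamma>t\<^sub>1 \<Gamma>t\<^sub>2"
    and B: "bounded_clinear B"
    and nonempty: "resolvent_set A_B \<noteq> {}"
    and \<mu>\<^sub>0: "\<mu>\<^sub>0 \<notin> spectrum A_B"
    and \<mu>t: "\<mu>t \<notin> spectrum At_B"
    and analytic_M: "point_of_analyticity (resolvent_set A_B) M_B z\<^sub>0"
    and limit_point: "z\<^sub>0 \<in> closure (resolvent_set A_B)"
  shows "(\<forall>N M V W. N > 0 \<and> M > 0 \<and>
            csubspace V \<and> V \<subseteq> S \<and> cdim V = N \<and> csubspace W \<and> W \<subseteq> St \<and> cdim W = M \<longrightarrow>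
            point_of_analyticity (resolvent_set A_B)
              (\<lambda>z. orth_proj W \<circ> resolvent A_B z \<circ> orth_proj V) z\<^sub>0)
       \<and> (\<forall>N M V W. N > 0 \<and> M > 0 \<and>
            csubspace V \<and> V \<subseteq> T \<and> cdim V = N \<and> csubspace W \<and> W \<subseteq> Tt \<and> cdim W = M \<longrightarrow>
            point_of_analyticity (resolvent_set A_B)
              (\<lambda>z. orth_proj W \<circ> resolvent A_B z \<circ> orth_proj V) z\<^sub>0)"
proof -
  interpret boundary_triplet A At \<Gamma>\<^sub>1 \<Gamma>\<^sub>2 \<Gamma>t\<^sub>1 \<Gamma>t\<^sub>2
    by (rule triplet)
  have adj: "op_adjoint At_B = A_B"
    unfolding A_B_def At_B_def by (rule op_adjoint_restriction[OF B])
  obtain U F where UF: "z\<^sub>0 \<in> U" "analytic_continuation (resolvent_set A_B) M_B U F"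
    using analytic_M unfolding point_of_analyticity_def by blast
  let ?E = "ran_solution_op (op_adjoint At) \<Gamma>\<^sub>1 \<Gamma>\<^sub>2 B"
  let ?Et = "ran_solution_op (op_adjoint A) \<Gamma>t\<^sub>1 \<Gamma>t\<^sub>2 (cadjoint B)"
  have base: "continuable A_B z\<^sub>0 d e"
    if "\<mu> \<in> resolvent_set A_B" "d \<in> ?E \<mu>" "\<nu> \<in> resolvent_set At_B" "e \<in> ?Et \<nu>" for \<mu> \<nu> d e
  proof (cases "z\<^sub>0 \<in> resolvent_set A_B")
    case True
    then show ?thesis by (rule continuable_resolvent_set)
  next
    case False
    moreover have "cnj \<nu> \<in> resolvent_set A_B"
      using op_adjoint_resolvent(1)[OF that(3)] by (simp add: adj)
    ultimately have "z\<^sub>0 \<noteq> \<mu>" "z\<^sub>0 \<noteq> cnj \<nu>"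
      using that(1) by auto
    moreover have "d \<in> eigenspace (op_adjoint At) \<mu>" "e \<in> eigenspace (op_adjoint A) \<nu>"
      using that ran_solution_op_subset by blast+
    ultimately show ?thesis
      using UF continuable_eigenspaces[OF B] unfolding A_B_def M_B_def by blast
  qed
  have "continuable A_B z\<^sub>0 d e" if "d \<in> S" "e \<in> St" for d e
  proof (rule continuable_cspan[OF _ that[unfolded S_def St_def S_space_def, folded A_B_def At_B_def]])
    fix x y
    assume x: "x \<in> (\<Union>\<delta>\<in>- spectrum A_B. resolvent A_B \<delta> ` ?E \<mu>\<^sub>0)"
      and y: "y \<in> (\<Union>\<delta>\<in>- spectrum At_B. resolvent At_B \<delta> ` ?Et \<mu>t)"
    from x obtain \<delta> d where \<delta>: "\<delta> \<in> resolvent_set A_B" "x = resolvent A_B \<delta> d" "d \<in> ?E \<mu>\<^sub>0"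
      by (auto simp: spectrum_def)
    from y obtain \<epsilon> e where \<epsilon>: "\<epsilon> \<in> resolvent_set At_B" "y = resolvent At_B \<epsilon> e" "e \<in> ?Et \<mu>t"
      by (auto simp: spectrum_def)
    show "continuable A_B z\<^sub>0 x y"
    proof (cases "z\<^sub>0 \<in> resolvent_set A_B")
      case True
      then show ?thesis by (rule continuable_resolvent_set)
    next
      case False
      \<comment> \<open>Starting from kernel vectors, the resolvent is applied first to the left
        vector and then to the right one, both steps using that \<open>z\<^sub>0\<close> is in the
        spectrum.\<close>
      have "continuable A_B z\<^sub>0 d e"
        using \<mu>\<^sub>0 \<mu>t \<delta>(3) \<epsilon>(3) by (intro base) (auto simp: spectrum_def)
      then have "continuable A_B z\<^sub>0 x e"
        unfolding \<delta>(2) using False \<delta>(1) by (intro continuable_resolvent_left) auto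
      then show ?thesis
        using continuable_resolvent_right[of At_B z\<^sub>0 x e \<epsilon>] False \<epsilon> by (simp add: adj)
    qed
  qed
  moreover have "continuable A_B z\<^sub>0 d e" if "d \<in> T" "e \<in> Tt" for d e
  proof (rule continuable_cspan[OF _ that[unfolded T_def Tt_def T_space_def, folded A_B_def At_B_def]])
    fix x y
    assume "x \<in> (\<Union>\<mu>\<in>- spectrum A_B. ?E \<mu>)" "y \<in> (\<Union>\<mu>\<in>- spectrum At_B. ?Et \<mu>)"
    then show "continuable A_B z\<^sub>0 x y"
      using base by (auto simp: spectrum_def)
  qed
  ultimately show ?thesis
    \<comment> \<open>Positivity of N and M enters as positivity of \<open>cdim\<close>, which
      supplies finite orthonormal bases of the two subspaces.\<close>
    by (blast intro: point_of_analyticity_compression[OF limit_point])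
qed

end
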